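(* Let $ABC$ be an equilateral triangle that is $N$-tiled by a tile with angles $(\alpha,\beta,\pi/3)$, where $\beta$ is not a rational multiple of $\pi$, and let $M$ be the coloring number of the tiling. Then: (i) $\zeta = e^{i\alpha}$ satisfies a quadratic equation whose coefficients lie in $\mathbb{Q}(i\sqrt3)$ and are given by expressions in $N$ and $M$; (ii) $N$ and $M$ determine the shape of the tile uniquely: the two ratios $a/c$ and $b/c$ are (in some order) the two numbers $$\frac12\left(\frac{3N+M^2}{3N-M^2} \pm \frac{\sqrt{(9N-M^2)(N-M^2)}}{3N-M^2}\right);$$ (iii) $M^2 < N$.
   Context: An $N$-tiling of a triangle $ABC$ by a tile $T$ is a decomposition of $ABC$ into $N$ triangles, each congruent to $T$, with pairwise disjoint interiors. The tile has angles $\alpha,\beta,\gamma=\pi/3$ and side lengths $a,b,c$ opposite $\alpha,\beta,\gamma$ respectively. Coloring number: in such a tiling the tiles can be colored black and white so that any two tiles whose boundaries share a segment of positive length have different colors and the single tile at vertex $A$ is black; the coloring number $M$ is the number of black tiles minus the number of white tiles. *)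

theory Defs
  imports "HOL-Analysis.Analysis" "HOL-Computational_Algebra.Polynomial"
begin

text \<open>The Euclidean plane is the type \<^typ>\<open>complex\<close>.\<close>

definition is_triangle :: "complex \<Rightarrow> complex \<Rightarrow> complex \<Rightarrow> bool" where
  "is_triangle A B C \<longleftrightarrow> \<not> collinear {A, B, C}"

definition solid_triangle :: "complex \<Rightarrow> complex \<Rightarrow> complex \<Rightarrow> complex set" where
  "solid_triangle A B C = convex hull {A, B, C}"

definition equilateral :: "complex \<Rightarrow> complex \<Rightarrow> complex \<Rightarrow> bool" where
  "equilateral A B C \<longleftrightarrow> is_triangle A B C \<and> dist A B = dist B C \<and> dist B C = dist C A"

text \<open>The angle at the middle argument, in \<open>[0, \<pi>]\<close>.\<close>

definition angle :: "complex \<Rightarrow> complex \<Rightarrow> complex \<Rightarrow> real" where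
  "angle X Y Z = arccos (((X - Y) \<bullet> (Z - Y)) / (norm (X - Y) * norm (Z - Y)))"

text \<open>Orientation-reversing isometries are allowed: a tile may be turned over.\<close>

definition congruent_sets :: "complex set \<Rightarrow> complex set \<Rightarrow> bool" where
  "congruent_sets S T \<longleftrightarrow>
     (\<exists>f :: complex \<Rightarrow> complex. (\<forall>x y. dist (f x) (f y) = dist x y) \<and> f ` S = T)"

text \<open>The tiles need not meet edge to edge.\<close>

definition is_tiling :: "nat \<Rightarrow> complex set \<Rightarrow> complex set \<Rightarrow> complex set set \<Rightarrow> bool" where
  "is_tiling N T D \<T> \<longleftrightarrow>
     finite \<T> \<and> card \<T> = N \<and>
     (\<forall>t\<in>\<T>. congruent_sets T t) \<and>
     \<Union>\<T> = D \<and>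
     (\<forall>s\<in>\<T>. \<forall>t\<in>\<T>. s \<noteq> t \<longrightarrow> interior s \<inter> interior t = {})"

definition share_segment :: "complex set \<Rightarrow> complex set \<Rightarrow> bool" where
  "share_segment s t \<longleftrightarrow> (\<exists>x y. x \<noteq> y \<and> closed_segment x y \<subseteq> frontier s \<inter> frontier t)"

text \<open>A colouring is given by its set \<open>\<B>\<close> of black tiles.\<close>

definition is_coloring :: "complex set set \<Rightarrow> complex \<Rightarrow> complex set set \<Rightarrow> bool" where
  "is_coloring \<T> A \<B> \<longleftrightarrow>
     \<B> \<subseteq> \<T> \<and>
     (\<forall>s\<in>\<T>. \<forall>t\<in>\<T>. s \<noteq> t \<and> share_segment s t \<longrightarrow> (s \<in> \<B> \<longleftrightarrow> t \<notin> \<B>)) \<and>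
     (\<forall>t\<in>\<T>. A \<in> t \<longrightarrow> t \<in> \<B>)"

text \<open>Meaningful only if a colouring exists and all colourings give the same difference, as
  is the case for the tilings considered here.\<close>

definition coloring_number :: "complex set set \<Rightarrow> complex \<Rightarrow> int" where
  "coloring_number \<T> A =
     (THE M. \<exists>\<B>. is_coloring \<T> A \<B> \<and> M = int (card \<B>) - int (card (\<T> - \<B>)))"

text \<open>The field \<open>\<rat>(i\<surd>3)\<close>: the smallest subfield of the complex numbers containing
  \<open>i\<surd>3\<close>.\<close>

definition is_subfield :: "complex set \<Rightarrow> bool" where
  "is_subfield K \<longleftrightarrow> 0 \<in> K \<and> 1 \<in> K \<and>
     (\<forall>x\<in>K. \<forall>y\<in>K. x - y \<in> K \<and> x * y \<in> K) \<and> (\<forall>x\<in>K. inverse x \<in> K)"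

definition Q_isqrt3 :: "complex set" where
  "Q_isqrt3 = \<Inter>{K. is_subfield K \<and> \<i> * complex_of_real (sqrt 3) \<in> K}"

text \<open>Polynomials in two variables, as polynomials in the first variable whose coefficients are
  polynomials in the second.\<close>

definition poly2_over :: "complex set \<Rightarrow> complex poly poly \<Rightarrow> bool" where
  "poly2_over K p \<longleftrightarrow> (\<forall>i j. coeff (coeff p i) j \<in> K)"

definition eval2 :: "complex poly poly \<Rightarrow> complex \<Rightarrow> complex \<Rightarrow> complex" where
  "eval2 p x y = poly (poly p [:x:]) y"

end

theory Submission
  imports Defs
begin

text \<open>For a direction \<open>d\<close> and a height \<open>h\<close>, let each counterclockwise edge of a triangle lying on
  the line \<open>(d, h)\<close> count with its length, signed by whether it runs along \<open>d\<close> or against it. This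
  signed length is the integral along the line of the jump of the indicator function of the triangle
  across the line, and at all but finitely many points the jumps of the tiles of a dissection add up
  to the jump of the dissected triangle. So signed length is additive over dissections. Hence, for
  every weight \<open>w\<close> with \<open>w (- d) (- h) = - w d h\<close>, the weighted boundary length is additive. Two
  weights are needed. The weight \<open>h\<close> gives the area identity \<open>X\<^sup>2 = N a b\<close>, where \<open>X\<close> is the side of
  \<open>ABC\<close>. For the other one take a \<open>\<rat>\<close>-linear \<open>\<rho>\<close> with \<open>\<rho> (\<pi>/3) = \<rho> \<beta> = 1\<close>, which exists because
  \<open>\<beta>/\<pi>\<close> is irrational; then also \<open>\<rho> \<alpha> = 1\<close>, and the parity of \<open>\<lfloor>\<rho> (arg d)\<rfloor>\<close>, with arguments
  measured from \<open>AB\<close>, is the same for the three edges of a tile, changes under \<open>d \<mapsto> - d\<close>, and is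
  even for the sides of \<open>ABC\<close>. This parity is the colouring, unique since tiles are connected
  through shared segments, and the weighted length identity reads \<open>M (a + b + c) = 3 X\<close>. Together
  with \<open>c\<^sup>2 = a\<^sup>2 + b\<^sup>2 - a b\<close> the two identities give
  \<open>(a + b) / c = (3 N + M\<^sup>2) / (3 N - M\<^sup>2)\<close>, and this ratio equals \<open>2 cos (\<alpha> - \<pi>/3)\<close>.\<close>

section \<open>Triangles and the jump of their indicator functions across a line\<close>

definition cross :: "complex \<Rightarrow> complex \<Rightarrow> real" where
  "cross u v = Re u * Im v - Im u * Re v"

text \<open>Twice the signed area of the triangle \<open>p q z\<close>; positive exactly when
  \<open>z\<close> lies to the left of the line from \<open>p\<close> to \<open>q\<close>.\<close>

definition side :: "complex \<Rightarrow> complex \<Rightarrow> complex \<Rightarrow> real" where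
  "side p q z = cross (q - p) (z - p)"

text \<open>The edges run counterclockwise, so the triangle lies to the left of each. As a set of
  pairs they do not depend on which vertex is named first.\<close>

definition boundary_edges :: "complex set \<Rightarrow> (complex \<times> complex) set \<Rightarrow> bool" where
  "boundary_edges t E \<longleftrightarrow>
     (\<exists>p q r. t = solid_triangle p q r \<and> side p q r > 0 \<and> E = {(p, q), (q, r), (r, p)})"

lemma side_cycle: "side q r p = side p q r" "side r p q = side p q r"
  by (simp_all add: side_def cross_def algebra_simps)

lemma side_cycle_pos:
  "side q r p > 0 \<longleftrightarrow> side p q r > 0" "side r p q > 0 \<longleftrightarrow> side p q r > 0"
  by (simp_all only: side_cycle(1)[of q r p] side_cycle(2)[of r p q])

lemma side_sum: "side p q z + side q r z + side r p z = side p q r"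
  by (simp add: side_def cross_def algebra_simps)

lemma side_self [simp]: "side p q p = 0" "side p q q = 0" "side p p z = 0"
  by (simp_all add: side_def cross_def)

lemma side_convex3:
  assumes "u + v + w = 1"
  shows "side p q (u *\<^sub>R x + v *\<^sub>R y + w *\<^sub>R z) = u * side p q x + v * side p q y + w * side p q z"
proof -
  have "u = 1 - v - w" using assms by simp
  show ?thesis unfolding \<open>u = 1 - v - w\<close> by (simp add: side_def cross_def algebra_simps)
qed

lemma side_convex2:
  assumes "u + v = 1"
  shows "side p q (u *\<^sub>R x + v *\<^sub>R y) = u * side p q x + v * side p q y"
  using side_convex3[of u v 0 p q x y 0] assms by simp

text \<open>Barycentric coordinates are ratios of areas; with the denominator cleared, this is a
  polynomial identity in the coordinates of the points.\<close>

lemma barycentric: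
  assumes "side p q r \<noteq> 0"
  shows "(side q r z / side p q r) *\<^sub>R p + (side r p z / side p q r) *\<^sub>R q
           + (side p q z / side p q r) *\<^sub>R r = z"
proof -
  have "side q r z *\<^sub>R p + side r p z *\<^sub>R q + side p q z *\<^sub>R r = side p q r *\<^sub>R z"
    by (simp add: complex_eq_iff side_def cross_def algebra_simps)
  then have "inverse (side p q r) *\<^sub>R (side q r z *\<^sub>R p + side r p z *\<^sub>R q + side p q z *\<^sub>R r) = z"
    using assms by simp
  then show ?thesis by (simp add: scaleR_add_right divide_inverse_commute)
qed

text \<open>Each of the three functions is affine and nonnegative at the vertices, hence on the
  hull. Conversely their values, divided by \<open>side p q r\<close>, are the barycentric
  coordinates of \<open>z\<close>.\<close>

lemma mem_solid_triangle_iff: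
  assumes "side p q r > 0"
  shows "z \<in> solid_triangle p q r \<longleftrightarrow> side p q z \<ge> 0 \<and> side q r z \<ge> 0 \<and> side r p z \<ge> 0"
proof
  assume "z \<in> solid_triangle p q r"
  then obtain u v w where uvw: "u \<ge> 0" "v \<ge> 0" "w \<ge> 0" "u + v + w = 1"
    and z: "z = u *\<^sub>R p + v *\<^sub>R q + w *\<^sub>R r"
    unfolding solid_triangle_def convex_hull_3 mem_Collect_eq by metis
  have "side q r p > 0" "side r p q > 0" using assms by (simp_all add: side_cycle_pos)
  then show "side p q z \<ge> 0 \<and> side q r z \<ge> 0 \<and> side r p z \<ge> 0"
    unfolding z side_convex3[OF uvw(4)] using uvw assms by simp
next
  assume *: "side p q z \<ge> 0 \<and> side q r z \<ge> 0 \<and> side r p z \<ge> 0"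
  have "side q r z / side p q r + side r p z / side p q r + side p q z / side p q r = 1"
    using side_sum[of p q z r] assms by (simp add: add_divide_distrib[symmetric])
  moreover have "z = (side q r z / side p q r) *\<^sub>R p + (side r p z / side p q r) *\<^sub>R q
           + (side p q z / side p q r) *\<^sub>R r"
    by (rule barycentric[symmetric]) (use assms in simp)
  moreover have "side q r z / side p q r \<ge> 0" "side r p z / side p q r \<ge> 0" "side p q z / side p q r \<ge> 0"
    using * assms by simp_all
  ultimately show "z \<in> solid_triangle p q r"
    unfolding solid_triangle_def convex_hull_3 mem_Collect_eq by metis
qed

lemma continuous_on_side [continuous_intros]: "continuous_on S (side p q)"
  unfolding side_def[abs_def] cross_def by (intro continuous_intros)

lemma interior_solid_triangleI:
  assumes "side p q r > 0" "side p q z > 0" "side q r z > 0" "side r p z > 0"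
  shows "z \<in> interior (solid_triangle p q r)"
proof (rule interiorI)
  let ?U = "{z. side p q z > 0} \<inter> {z. side q r z > 0} \<inter> {z. side r p z > 0}"
  show "open ?U"
    by (intro open_Int open_Collect_less continuous_intros)
  show "?U \<subseteq> solid_triangle p q r" by (auto simp: mem_solid_triangle_iff[OF assms(1)])
qed (use assms in auto)

text \<open>On the open edge \<open>p q\<close> the barycentric coordinate belonging to
  \<open>r\<close> vanishes and the other two are positive, and this characterizes it.\<close>

lemma open_segment_side:
  assumes "side p q r > 0"
  shows "z \<in> open_segment p q \<longleftrightarrow> side p q z = 0 \<and> side q r z > 0 \<and> side r p z > 0"
proof
  assume "z \<in> open_segment p q"
  then obtain u where u: "0 < u" "u < 1" and z: "z = (1 - u) *\<^sub>R p + u *\<^sub>R q"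
    by (auto simp: in_segment)
  have "side q r p > 0" "side r p q > 0" using assms by (simp_all add: side_cycle_pos)
  then show "side p q z = 0 \<and> side q r z > 0 \<and> side r p z > 0"
    unfolding z using u by (subst (1 2 3) side_convex2) auto
next
  assume *: "side p q z = 0 \<and> side q r z > 0 \<and> side r p z > 0"
  define u where "u = side r p z / side p q r"
  have e: "side q r z / side p q r = 1 - u"
    using side_sum[of p q z r] * assms by (simp add: u_def field_simps)
  have "z = (1 - u) *\<^sub>R p + u *\<^sub>R q"
    using barycentric[of p q r z] assms unfolding e u_def[symmetric] by (simp add: *)
  moreover have "0 < u" using * assms by (simp add: u_def)
  moreover have "0 < 1 - u" using e * assms by (metis divide_pos_pos)
  moreover have "p \<noteq> q" using assms by auto
  ultimately show "z \<in> open_segment p q" by (auto simp: in_segment)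
qed

section \<open>Edge sets of triangles\<close>

lemma boundary_edges_distinct:
  assumes "side p q r > 0"
  shows "p \<noteq> q" "q \<noteq> r" "r \<noteq> p"
  using assms by (auto simp: side_def cross_def)

lemma boundary_edges_sum:
  assumes "side p q r > 0"
  shows "(\<Sum>e\<in>{(p, q), (q, r), (r, p)}. g e) = g (p, q) + g (q, r) + (g (r, p) :: real)"
  using boundary_edges_distinct[OF assms] by (simp add: add.assoc)

lemma boundary_edges_finite: "boundary_edges t E \<Longrightarrow> finite E"
  unfolding boundary_edges_def by auto

lemma boundary_edges_distinct_ends: "boundary_edges t E \<Longrightarrow> (p, q) \<in> E \<Longrightarrow> p \<noteq> q"
  unfolding boundary_edges_def using boundary_edges_distinct by auto

lemma boundary_edges_rotate:
  assumes "boundary_edges t E" "(p, q) \<in> E"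
  obtains r where "t = solid_triangle p q r" "side p q r > 0" "E = {(p, q), (q, r), (r, p)}"
proof -
  obtain p' q' r' where t: "t = solid_triangle p' q' r'" "side p' q' r' > 0"
    and E: "E = {(p', q'), (q', r'), (r', p')}"
    using assms(1) unfolding boundary_edges_def by blast
  consider "p = p'" "q = q'" | "p = q'" "q = r'" | "p = r'" "q = p'"
    using assms(2) E by auto
  then show thesis
  proof cases
    case 1
    then show ?thesis using t E that[of r'] by simp
  next
    case 2
    have "t = solid_triangle q' r' p'" using t by (simp add: solid_triangle_def insert_commute)
    moreover have "E = {(q', r'), (r', p'), (p', q')}" using E by blast
    ultimately show ?thesis using 2 t that[of p'] side_cycle_pos(1)[of q' r' p'] by blast
  next
    case 3
    have "t = solid_triangle r' p' q'" using t by (simp add: solid_triangle_def insert_commute)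
    moreover have "E = {(r', p'), (p', q'), (q', r')}" using E by blast
    ultimately show ?thesis using 3 t(2) that[of q'] side_cycle_pos(2)[of r' p' q'] by blast
  qed
qed

lemma boundary_edges_mem_iff:
  assumes "boundary_edges t E"
  shows "z \<in> t \<longleftrightarrow> (\<forall>(p, q)\<in>E. side p q z \<ge> 0)"
  using assms mem_solid_triangle_iff unfolding boundary_edges_def by auto

lemma boundary_edges_interiorI:
  assumes "boundary_edges t E" "\<forall>(p, q)\<in>E. side p q z > 0"
  shows "z \<in> interior t"
  using assms interior_solid_triangleI unfolding boundary_edges_def by auto

text \<open>The point may lie on the line carrying an edge only if that edge is parallel to
  \<open>d\<close>. Near such a point, a crossing along \<open>\<i> * d\<close> is governed by the
  parallel edges alone.\<close>

definition generic :: "complex \<Rightarrow> complex \<Rightarrow> (complex \<times> complex) set \<Rightarrow> bool" where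
  "generic d x E \<longleftrightarrow> (\<forall>(p, q)\<in>E. cross d (q - p) \<noteq> 0 \<longrightarrow> side p q x \<noteq> 0)"

text \<open>The interior lies to the left of a counterclockwise edge. Crossing the edge in the
  direction \<open>\<i> * d\<close> therefore enters the triangle if the edge runs along
  \<open>d\<close> and leaves it if the edge runs against \<open>d\<close>.\<close>

definition jump :: "complex \<Rightarrow> complex \<Rightarrow> complex \<times> complex \<Rightarrow> real" where
  "jump d x = (\<lambda>(p, q). if x \<in> open_segment p q \<and> cross d (q - p) = 0 then sgn (d \<bullet> (q - p)) else 0)"

lemma side_normal: "side p q (x + of_real e * \<i> * d) = side p q x + e * (d \<bullet> (q - p))"
  by (simp add: side_def cross_def inner_complex_def algebra_simps)

lemma cross_inner_zero:
  assumes "cross d u = 0" "d \<bullet> u = 0" "d \<noteq> 0"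
  shows "u = 0"
proof -
  have "(cross d u)\<^sup>2 + (d \<bullet> u)\<^sup>2 = (norm d)\<^sup>2 * (norm u)\<^sup>2"
    unfolding cmod_power2 cross_def inner_complex_def by algebra
  then show ?thesis using assms by auto
qed

lemma cross_parallel:
  assumes "cross d u = 0" "cross d v = 0" "d \<noteq> 0"
  shows "cross u v = 0"
proof -
  have "(Re d) * cross u v = Re u * cross d v - Re v * cross d u"
       "(Im d) * cross u v = Im u * cross d v - Im v * cross d u"
    by (simp_all add: cross_def algebra_simps)
  then show ?thesis using assms by (auto simp: complex_eq_iff)
qed

text \<open>A perturbation smaller than \<open>\<bar>s\<bar>\<close> keeps the sign of
  \<open>s\<close>; at \<open>s = 0\<close> the sign of the slope decides. Both directions are
  treated together because a jump compares the two sides of a line.\<close>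

lemma eventually_sgn_perturb:
  assumes "s = 0 \<longrightarrow> k \<noteq> (0::real)"
  shows "\<forall>\<^sub>F e in at_right (0::real). sgn (s + e * k) = (if s = 0 then sgn k else sgn s)
                               \<and> sgn (s - e * k) = (if s = 0 then - sgn k else sgn s)"
proof (cases "s = 0")
  case True
  have "\<forall>\<^sub>F e in at_right (0::real). e > 0" by (simp add: eventually_at_right_less)
  then show ?thesis by eventually_elim (use True in \<open>auto simp: sgn_mult\<close>)
next
  case False
  have "((\<lambda>e. s + e * k) \<longlongrightarrow> s + 0 * k) (at_right 0)" "((\<lambda>e. s - e * k) \<longlongrightarrow> s - 0 * k) (at_right 0)"
    by (intro tendsto_intros)+
  then have "\<forall>\<^sub>F e in at_right 0. dist (s + e * k) s < \<bar>s\<bar>" "\<forall>\<^sub>F e in at_right 0. dist (s - e * k) s < \<bar>s\<bar>"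
    using False by (auto simp: tendsto_iff)
  then show ?thesis
    by eventually_elim (use False in \<open>auto simp: sgn_if dist_real_def\<close>)
qed

text \<open>Here \<open>s1\<close>, \<open>s2\<close>, \<open>s3\<close> stand for the values of the
  three edge functions at a point and \<open>k1\<close>, \<open>k2\<close>, \<open>k3\<close> for
  their slopes along the normal. At most one value vanishes; the indicators on the two sides differ
  only if one does and the other two values are positive, and then by the sign of its slope.\<close>

lemma indicator_difference_signs:
  fixes s1 s2 s3 k1 k2 k3 :: real
  assumes "s1 = 0 \<longrightarrow> k1 \<noteq> 0" "s2 = 0 \<longrightarrow> k2 \<noteq> 0" "s3 = 0 \<longrightarrow> k3 \<noteq> 0"
    and "\<not> (s1 = 0 \<and> s2 = 0)" "\<not> (s2 = 0 \<and> s3 = 0)" "\<not> (s3 = 0 \<and> s1 = 0)"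
  shows "of_bool ((s1 > 0 \<or> s1 = 0 \<and> k1 > 0) \<and> (s2 > 0 \<or> s2 = 0 \<and> k2 > 0) \<and> (s3 > 0 \<or> s3 = 0 \<and> k3 > 0))
    - of_bool ((s1 > 0 \<or> s1 = 0 \<and> k1 < 0) \<and> (s2 > 0 \<or> s2 = 0 \<and> k2 < 0) \<and> (s3 > 0 \<or> s3 = 0 \<and> k3 < 0))
    = (if s1 = 0 \<and> s2 > 0 \<and> s3 > 0 then sgn k1 else 0) + (if s2 = 0 \<and> s3 > 0 \<and> s1 > 0 then sgn k2 else 0)
      + (if s3 = 0 \<and> s1 > 0 \<and> s2 > 0 then sgn k3 else (0::real))"
proof -
  consider "s1 = 0" "s2 \<noteq> 0" "s3 \<noteq> 0" | "s2 = 0" "s1 \<noteq> 0" "s3 \<noteq> 0" | "s3 = 0" "s2 \<noteq> 0" "s1 \<noteq> 0"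
    | "s1 \<noteq> 0" "s2 \<noteq> 0" "s3 \<noteq> 0" using assms by blast
  then show ?thesis
    by cases (use assms in \<open>auto simp: sgn_if of_bool_def not_less\<close>)
qed

text \<open>For small \<open>e\<close> the signs of the edge functions on both sides of the line are
  known to first order. The second conjunct keeps the two points off all edge lines, where
  membership in a tile amounts to membership in its interior.\<close>

lemma eventually_jump:
  assumes t: "boundary_edges t E" and d: "d \<noteq> 0" and gen: "generic d x E"
  shows "\<forall>\<^sub>F e in at_right 0.
     indicator t (x + of_real e * \<i> * d) - indicator t (x - of_real e * \<i> * d) = (\<Sum>e\<in>E. jump d x e) \<and>
     (\<forall>(p, q)\<in>E. side p q (x + of_real e * \<i> * d) \<noteq> 0 \<and> side p q (x - of_real e * \<i> * d) \<noteq> 0)"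
proof -
  obtain p q r where tri: "t = solid_triangle p q r" and pos: "side p q r > 0"
    and E: "E = {(p, q), (q, r), (r, p)}"
    using t unfolding boundary_edges_def by blast
  have neg: "side u v (x - of_real e * \<i> * d) = side u v x - e * (d \<bullet> (v - u))" for u v e
    using side_normal[of u v x "-e" d] by simp
  \<comment> \<open>By genericity an edge whose line contains \<open>x\<close> is parallel to
    \<open>d\<close>, and a nonzero vector parallel to \<open>d\<close> is not orthogonal to
    it.\<close>
  have par: "cross d (v - u) = 0 \<and> d \<bullet> (v - u) \<noteq> 0" if "(u, v) \<in> E" "side u v x = 0" for u v
    using gen that cross_inner_zero[OF _ _ d, of "v - u"] boundary_edges_distinct_ends[OF t, of u v]
    unfolding generic_def by auto
  have ev: "\<forall>\<^sub>F e in at_right 0.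
      sgn (side u v (x + of_real e * \<i> * d)) = (if side u v x = 0 then sgn (d \<bullet> (v - u)) else sgn (side u v x)) \<and>
      sgn (side u v (x - of_real e * \<i> * d)) = (if side u v x = 0 then - sgn (d \<bullet> (v - u)) else sgn (side u v x))"
    if "(u, v) \<in> E" for u v
    unfolding side_normal neg by (rule eventually_sgn_perturb) (use par[OF that] in auto)
  \<comment> \<open>Two edge lines through \<open>x\<close> would both be parallel to
    \<open>d\<close>, so the triangle would be degenerate.\<close>
  have no2: "\<not> (side p q x = 0 \<and> side q r x = 0)" "\<not> (side q r x = 0 \<and> side r p x = 0)"
    "\<not> (side r p x = 0 \<and> side p q x = 0)"
  proof -
    have "cross (q - p) (r - q) \<noteq> 0" "cross (r - q) (p - r) \<noteq> 0" "cross (p - r) (q - p) \<noteq> 0"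
      using pos by (auto simp: side_def cross_def algebra_simps)
    then show "\<not> (side p q x = 0 \<and> side q r x = 0)" "\<not> (side q r x = 0 \<and> side r p x = 0)"
      "\<not> (side r p x = 0 \<and> side p q x = 0)"
      using par E cross_parallel[OF _ _ d] by (metis insert_iff)+
  qed
  have os: "x \<in> open_segment p q \<longleftrightarrow> side p q x = 0 \<and> side q r x > 0 \<and> side r p x > 0"
    "x \<in> open_segment q r \<longleftrightarrow> side q r x = 0 \<and> side r p x > 0 \<and> side p q x > 0"
    "x \<in> open_segment r p \<longleftrightarrow> side r p x = 0 \<and> side p q x > 0 \<and> side q r x > 0"
    using open_segment_side[of p q r x] open_segment_side[of q r p x] open_segment_side[of r p q x]
      pos side_cycle_pos(1)[of q r p] side_cycle_pos(2)[of r p q] by blast+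
  have "(p, q) \<in> E" "(q, r) \<in> E" "(r, p) \<in> E" unfolding E by auto
  note ev' = ev[OF this(1)] ev[OF this(2)] ev[OF this(3)]
  from ev' show ?thesis
  proof eventually_elim
    case (elim e)
    have P: "side p q x = 0 \<longrightarrow> cross d (q - p) = 0 \<and> d \<bullet> (q - p) \<noteq> 0"
            "side q r x = 0 \<longrightarrow> cross d (r - q) = 0 \<and> d \<bullet> (r - q) \<noteq> 0"
            "side r p x = 0 \<longrightarrow> cross d (p - r) = 0 \<and> d \<bullet> (p - r) \<noteq> 0"
      using par E by auto
    have nz: "\<forall>(p, q)\<in>E. side p q (x + of_real e * \<i> * d) \<noteq> 0 \<and> side p q (x - of_real e * \<i> * d) \<noteq> 0"
    proof -
      have "side u v (x + of_real e * \<i> * d) \<noteq> 0 \<and> side u v (x - of_real e * \<i> * d) \<noteq> 0"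
        if "sgn (side u v (x + of_real e * \<i> * d)) = (if side u v x = 0 then sgn (d \<bullet> (v - u)) else sgn (side u v x)) \<and>
          sgn (side u v (x - of_real e * \<i> * d)) = (if side u v x = 0 then - sgn (d \<bullet> (v - u)) else sgn (side u v x))"
          "side u v x = 0 \<longrightarrow> cross d (v - u) = 0 \<and> d \<bullet> (v - u) \<noteq> 0" for u v
        using that by (metis neg_equal_0_iff_equal sgn_zero_iff)
      from this[OF elim(1) P(1)] this[OF elim(2) P(2)] this[OF elim(3) P(3)]
      show ?thesis unfolding E by blast
    qed
    have S: "(\<Sum>e\<in>E. jump d x e) = jump d x (p, q) + jump d x (q, r) + jump d x (r, p)"
      unfolding E by (rule boundary_edges_sum[OF pos])
    \<comment> \<open>The perturbed values are nonzero, so weak inequalities can be decided by the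
      sign of the value or, where it vanishes, of the slope.\<close>
    have pm: "a \<ge> 0 \<longleftrightarrow> s > 0 \<or> s = 0 \<and> k > 0" "b \<ge> 0 \<longleftrightarrow> s > 0 \<or> s = 0 \<and> k < 0"
      if "sgn a = (if s = 0 then sgn k else sgn s) \<and> sgn b = (if s = 0 then - sgn k else sgn s)"
        "s = 0 \<longrightarrow> C \<and> k \<noteq> 0" for a b s k :: real and C
      using that by (cases "s = 0"; simp add: sgn_if split: if_splits)+
    have os': "jump d x (p, q) = (if side p q x = 0 \<and> side q r x > 0 \<and> side r p x > 0 then sgn (d \<bullet> (q - p)) else 0)"
      "jump d x (q, r) = (if side q r x = 0 \<and> side r p x > 0 \<and> side p q x > 0 then sgn (d \<bullet> (r - q)) else 0)"
      "jump d x (r, p) = (if side r p x = 0 \<and> side p q x > 0 \<and> side q r x > 0 then sgn (d \<bullet> (p - r)) else 0)"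
      using P os unfolding jump_def prod.case by meson+
    have A: "of_bool ((0 < side p q x \<or> side p q x = 0 \<and> 0 < d \<bullet> (q - p)) \<and>
           (0 < side q r x \<or> side q r x = 0 \<and> 0 < d \<bullet> (r - q)) \<and>
           (0 < side r p x \<or> side r p x = 0 \<and> 0 < d \<bullet> (p - r))) -
         of_bool ((0 < side p q x \<or> side p q x = 0 \<and> d \<bullet> (q - p) < 0) \<and>
           (0 < side q r x \<or> side q r x = 0 \<and> d \<bullet> (r - q) < 0) \<and>
           (0 < side r p x \<or> side r p x = 0 \<and> d \<bullet> (p - r) < 0)) =
         jump d x (p, q) + jump d x (q, r) + jump d x (r, p)"
    proof -
      have P': "side p q x = 0 \<longrightarrow> d \<bullet> (q - p) \<noteq> 0" "side q r x = 0 \<longrightarrow> d \<bullet> (r - q) \<noteq> 0"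
        "side r p x = 0 \<longrightarrow> d \<bullet> (p - r) \<noteq> 0" using P by blast+
      show ?thesis unfolding os' using indicator_difference_signs[OF P' no2] .
    qed
    have I: "indicator t (x + of_real e * \<i> * d) - indicator t (x - of_real e * \<i> * d) = (\<Sum>e\<in>E. jump d x e)"
      unfolding S A[symmetric] indicator_def
      unfolding tri mem_solid_triangle_iff[OF pos]
      unfolding pm(1)[OF elim(1) P(1)] pm(1)[OF elim(2) P(2)] pm(1)[OF elim(3) P(3)]
         pm(2)[OF elim(1) P(1)] pm(2)[OF elim(2) P(2)] pm(2)[OF elim(3) P(3)]
      by (rule refl)
    show ?case using nz I by simp
  qed
qed

section \<open>Additivity of weighted boundary lengths\<close>

lemma unit_frame:
  assumes "norm d = 1"
  shows "(d \<bullet> u) *\<^sub>R d + cross d u *\<^sub>R (\<i> * d) = u"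
proof -
  have "(Re d)\<^sup>2 + (Im d)\<^sup>2 = 1" using assms by (metis cmod_power2 power_one)
  moreover have "(d \<bullet> u) * Re d - cross d u * Im d = Re u * ((Re d)\<^sup>2 + (Im d)\<^sup>2)"
    "(d \<bullet> u) * Im d + cross d u * Re d = Im u * ((Re d)\<^sup>2 + (Im d)\<^sup>2)"
    by (simp_all add: cross_def inner_complex_def power2_eq_square algebra_simps)
  ultimately show ?thesis by (simp add: complex_eq_iff)
qed

lemma parallel_unit:
  assumes "norm d = 1" "cross d u = 0" "u \<noteq> 0"
  shows "d = sgn u \<and> d \<bullet> u = norm u \<or> d = - sgn u \<and> d \<bullet> u = - norm u"
proof -
  define k where "k = d \<bullet> u"
  have u: "u = k *\<^sub>R d" using unit_frame[OF assms(1), of u] assms(2) by (simp add: k_def)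
  have "k \<noteq> 0" "norm u = \<bar>k\<bar>" "sgn u = sgn k *\<^sub>R d"
    using assms(1,3) unfolding u by (auto simp: sgn_scaleR sgn_div_norm[of d])
  then show ?thesis unfolding k_def[symmetric] by (cases "k > 0") auto
qed

text \<open>The line meant is the set of \<open>z\<close> with \<open>cross d z = h\<close>; for a
  unit vector \<open>d\<close> the height \<open>h\<close> is its signed distance from the
  origin.\<close>

definition signed_length :: "complex \<Rightarrow> real \<Rightarrow> complex \<times> complex \<Rightarrow> real" where
  "signed_length d h = (\<lambda>(p, q). if cross d (q - p) = 0 \<and> cross d p = h then d \<bullet> (q - p) else 0)"

text \<open>For a unit vector \<open>d\<close> this is the arc length parametrization of the line
  \<open>(d, h)\<close>, starting at the foot of the perpendicular from the origin.\<close>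

definition line_point :: "complex \<Rightarrow> real \<Rightarrow> real \<Rightarrow> complex" where
  "line_point d h s = (of_real s + \<i> * of_real h) * d"

lemma side_line_point: "side p q (line_point d h s) = side p q (line_point d h 0) - s * cross d (q - p)"
  by (simp add: line_point_def side_def cross_def algebra_simps)

text \<open>Along the line each edge function is affine in \<open>s\<close> with slope
  \<open>- cross d (q - p)\<close>, so every nonparallel edge excludes at most one
  parameter.\<close>

lemma finite_nongeneric:
  assumes "finite E"
  shows "finite {s. \<not> generic d (line_point d h s) E}"
proof -
  have "finite {s. cross d (q - p) \<noteq> 0 \<and> side p q (line_point d h s) = 0}" for p q
  proof (rule finite_subset)
    show "{s. cross d (q - p) \<noteq> 0 \<and> side p q (line_point d h s) = 0}
        \<subseteq> {side p q (line_point d h 0) / cross d (q - p)}"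
      by (subst side_line_point) (auto simp: field_simps)
  qed simp
  then have "finite (\<Union>(p, q)\<in>E. {s. cross d (q - p) \<noteq> 0 \<and> side p q (line_point d h s) = 0})"
    using assms by auto
  then show ?thesis by (rule rev_finite_subset) (auto simp: generic_def)
qed

lemma cross_line_point: "norm d = 1 \<Longrightarrow> cross d (line_point d h s) = h"
proof -
  assume "norm d = 1"
  then have "(Re d)\<^sup>2 + (Im d)\<^sup>2 = 1" by (metis cmod_power2 power_one)
  moreover have "cross d (line_point d h s) = h * ((Re d)\<^sup>2 + (Im d)\<^sup>2)"
    by (simp add: line_point_def cross_def algebra_simps power2_eq_square)
  ultimately show ?thesis by simp
qed

lemma line_point_inner:
  assumes "norm d = 1"
  shows "line_point d (cross d p) (d \<bullet> p) = p"
  using unit_frame[OF assms, of p] by (simp add: line_point_def scaleR_conv_of_real algebra_simps)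

lemma has_integral_indicator_Ioo:
  fixes a b :: real
  assumes "a \<le> b"
  shows "((\<lambda>s. if s \<in> {a<..<b} then c else 0) has_integral (b - a) * c) UNIV"
proof -
  have "((\<lambda>s. if s \<in> {a..b} then c else 0) has_integral (b - a) *\<^sub>R c) UNIV"
    unfolding has_integral_restrict_UNIV using has_integral_const_real[of c a b] assms by simp
  then have "((\<lambda>s. if s \<in> {a<..<b} then c else 0) has_integral (b - a) *\<^sub>R c) UNIV"
    by (rule has_integral_spike_finite[where S = "{a, b}", rotated 2]) auto
  then show ?thesis by simp
qed

text \<open>If the edge lies on the line, its parameters form the open interval between
  \<open>d \<bullet> p\<close> and \<open>d \<bullet> q\<close>, where the jump is constantly 1 or
  -1. Otherwise the jump vanishes along the whole line.\<close>

lemma has_integral_jump: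
  assumes d: "norm d = 1"
  shows "((\<lambda>s. jump d (line_point d h s) (p, q)) has_integral signed_length d h (p, q)) UNIV"
proof (cases "cross d (q - p) = 0 \<and> cross d p = h")
  case False
  have "jump d (line_point d h s) (p, q) = 0" for s
  proof (cases "cross d (q - p) = 0 \<and> line_point d h s \<in> open_segment p q")
    case True
    then obtain u where u: "line_point d h s = (1 - u) *\<^sub>R p + u *\<^sub>R q" by (auto simp: in_segment)
    have "cross d ((1 - u) *\<^sub>R p + u *\<^sub>R q) = cross d p + u * cross d (q - p)"
      by (simp add: cross_def algebra_simps)
    then have "cross d p = h" using True u cross_line_point[OF d, of h s] by simp
    with False True show ?thesis by simp
  qed (auto simp: jump_def)
  moreover have "signed_length d h (p, q) = 0" using False by (auto simp: signed_length_def)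
  ultimately show ?thesis by simp
next
  case True
  define a b where "a = d \<bullet> p" and "b = d \<bullet> q"
  have "cross d q = h" using True by (simp add: cross_def algebra_simps)
  then have p: "p = line_point d h a" and q: "q = line_point d h b"
    using line_point_inner[OF d] True unfolding a_def b_def by metis+
  have d0: "d \<noteq> 0" using d by auto
  have lin: "(1 - u) *\<^sub>R line_point d h a + u *\<^sub>R line_point d h b = line_point d h ((1 - u) * a + u * b)" for u
    by (simp add: line_point_def scaleR_conv_of_real algebra_simps)
  have inj: "line_point d h s = line_point d h t \<longleftrightarrow> s = t" for s t
    using d0 by (simp add: line_point_def)
  have seg: "line_point d h s \<in> open_segment p q \<longleftrightarrow> s \<in> open_segment a b" for s
    unfolding p q in_segment lin inj by simp
  have ba: "d \<bullet> (q - p) = b - a" by (simp add: a_def b_def inner_diff_right)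
  \<comment> \<open>Minimum and maximum are taken because the edge may run against \<open>d\<close>;
    the sign then restores the orientation.\<close>
  have eq: "jump d (line_point d h s) (p, q) = (if s \<in> {min a b<..<max a b} then sgn (b - a) else 0)" for s
    using True by (auto simp: jump_def seg ba open_segment_eq_real_ivl split: if_splits)
  have "(max a b - min a b) * sgn (b - a) = b - a" by (auto simp: sgn_if)
  then show ?thesis unfolding eq using has_integral_indicator_Ioo[of "min a b" "max a b" "sgn (b - a)"] True ba
    by (simp add: signed_length_def)
qed

definition weighted_length :: "(complex \<Rightarrow> real \<Rightarrow> real) \<Rightarrow> complex \<times> complex \<Rightarrow> real" where
  "weighted_length w = (\<lambda>(p, q). w (sgn (q - p)) (cross (sgn (q - p)) p) * norm (q - p))"

section \<open>Dissections of a triangle into triangles\<close>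

locale dissection =
  fixes \<T> :: "complex set set" and D :: "complex set"
    and E :: "complex set \<Rightarrow> (complex \<times> complex) set" and ED :: "(complex \<times> complex) set"
  assumes finite_tiles: "finite \<T>"
    and tiles_Union: "\<Union>\<T> = D"
    and tiles_disjoint: "\<And>s t. s \<in> \<T> \<Longrightarrow> t \<in> \<T> \<Longrightarrow> s \<noteq> t \<Longrightarrow> interior s \<inter> interior t = {}"
    and tile_edges: "\<And>t. t \<in> \<T> \<Longrightarrow> boundary_edges t (E t)"
    and outer_edges: "boundary_edges D ED"
begin

text \<open>Off all edge lines, a point of a tile is an interior point of it, and the interiors are
  disjoint, so \<open>y\<close> lies in at most one tile.\<close>

lemma indicator_sum:
  assumes "\<forall>t\<in>\<T>. \<forall>(p, q)\<in>E t. side p q y \<noteq> 0"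
  shows "(\<Sum>t\<in>\<T>. indicator t y) = (indicator D y :: real)"
proof (cases "y \<in> D")
  case True
  then obtain t where t: "t \<in> \<T>" "y \<in> t" using tiles_Union by auto
  have int: "y \<in> interior s" if "s \<in> \<T>" "y \<in> s" for s
  proof (rule boundary_edges_interiorI[OF tile_edges])
    show "\<forall>(p, q)\<in>E s. side p q y > 0"
      using that assms boundary_edges_mem_iff[OF tile_edges, of s y] by force
  qed (use that in auto)
  have "y \<notin> s" if "s \<in> \<T>" "s \<noteq> t" for s
    using int[OF t] int[of s] tiles_disjoint[of s t] that t by blast
  then have "(\<Sum>s\<in>\<T>. indicator s y) = (\<Sum>s\<in>\<T>. if s = t then 1 else (0::real))"
    using t by (intro sum.cong) (auto simp: indicator_def)
  then show ?thesis using t True finite_tiles by simp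
next
  case False
  then show ?thesis using tiles_Union by (auto simp: indicator_def)
qed

text \<open>The indicators of the tiles add up to that of \<open>D\<close> at both points
  \<open>x + of_real e * \<i> * d\<close> and \<open>x - of_real e * \<i> * d\<close>; subtracting
  gives the jumps.\<close>

lemma jump_sum:
  assumes d: "d \<noteq> 0" and gen: "\<forall>t\<in>\<T>. generic d x (E t)" "generic d x ED"
  shows "(\<Sum>t\<in>\<T>. \<Sum>e\<in>E t. jump d x e) = (\<Sum>e\<in>ED. jump d x e)"
proof -
  have "\<forall>\<^sub>F e in at_right 0. \<forall>t\<in>\<T>.
     indicator t (x + of_real e * \<i> * d) - indicator t (x - of_real e * \<i> * d) = (\<Sum>e\<in>E t. jump d x e) \<and>
     (\<forall>(p, q)\<in>E t. side p q (x + of_real e * \<i> * d) \<noteq> 0 \<and> side p q (x - of_real e * \<i> * d) \<noteq> 0)"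
    using finite_tiles gen(1) eventually_jump[OF tile_edges d] by (intro eventually_ball_finite) auto
  with eventually_jump[OF outer_edges d gen(2)]
  \<comment> \<open>The goal does not mention \<open>e\<close>, so it suffices to prove it for all
    small \<open>e\<close>, the filter being nontrivial.\<close>
  have "\<forall>\<^sub>F e in at_right (0::real). ?thesis"
  proof eventually_elim
    case (elim e)
    have "(\<Sum>t\<in>\<T>. \<Sum>e\<in>E t. jump d x e)
        = (\<Sum>t\<in>\<T>. indicator t (x + of_real e * \<i> * d) - indicator t (x - of_real e * \<i> * d))"
      using elim by (intro sum.cong) auto
    also have "\<dots> = indicator D (x + of_real e * \<i> * d) - indicator D (x - of_real e * \<i> * d)"
      unfolding sum_subtractf using elim(2) by (subst (1 2) indicator_sum) fastforce+
    also have "\<dots> = (\<Sum>e\<in>ED. jump d x e)" using elim by blast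
    finally show ?case .
  qed
  then show ?thesis by (simp add: eventually_const_iff)
qed

text \<open>Integrating \<open>jump_sum\<close> along the line; the finitely many nongeneric
  parameters do not affect the integral.\<close>

lemma signed_length_sum:
  assumes d: "norm d = 1"
  shows "(\<Sum>t\<in>\<T>. \<Sum>e\<in>E t. signed_length d h e) = (\<Sum>e\<in>ED. signed_length d h e)"
proof -
  let ?B = "(\<Union>t\<in>\<T>. {s. \<not> generic d (line_point d h s) (E t)}) \<union> {s. \<not> generic d (line_point d h s) ED}"
  have fin: "finite ED" "\<And>t. t \<in> \<T> \<Longrightarrow> finite (E t)"
    using boundary_edges_finite outer_edges tile_edges by blast+
  have B: "finite ?B" using finite_tiles fin finite_nongeneric by auto
  have J: "((\<lambda>s. jump d (line_point d h s) e) has_integral signed_length d h e) UNIV" for e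
    using has_integral_jump[OF d] by (cases e) auto
  have "((\<lambda>s. \<Sum>t\<in>\<T>. \<Sum>e\<in>E t. jump d (line_point d h s) e) has_integral
         (\<Sum>t\<in>\<T>. \<Sum>e\<in>E t. signed_length d h e)) UNIV"
    using finite_tiles fin J by (intro has_integral_sum) auto
  moreover have "((\<lambda>s. \<Sum>e\<in>ED. jump d (line_point d h s) e) has_integral
         (\<Sum>e\<in>ED. signed_length d h e)) UNIV"
    using fin J by (intro has_integral_sum) auto
  then have "((\<lambda>s. \<Sum>t\<in>\<T>. \<Sum>e\<in>E t. jump d (line_point d h s) e) has_integral
         (\<Sum>e\<in>ED. signed_length d h e)) UNIV"
  proof (rule has_integral_spike_finite[OF B, rotated])
    show "(\<Sum>t\<in>\<T>. \<Sum>e\<in>E t. jump d (line_point d h s) e) = (\<Sum>e\<in>ED. jump d (line_point d h s) e)"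
      if "s \<in> UNIV - ?B" for s
      using that d by (intro jump_sum) auto
  qed
  ultimately show ?thesis by (rule has_integral_unique)
qed

text \<open>Apply \<open>signed_length_sum\<close> to each directed line carrying an edge, multiply
  by \<open>w\<close> and sum. An edge contributes through \<open>(d, h)\<close> and
  \<open>(- d, - h)\<close>; since both \<open>w\<close> and the signed length change sign, the two
  contributions are equal and do not cancel.\<close>

theorem weighted_length_sum:
  assumes odd: "\<And>d h. w (- d) (- h) = - w d h"
  shows "(\<Sum>t\<in>\<T>. \<Sum>e\<in>E t. weighted_length w e) = (\<Sum>e\<in>ED. weighted_length w e)"
proof -
  define EE where "EE = (\<Union>t\<in>\<T>. E t) \<union> ED"
  have fin: "finite ED" "\<And>t. t \<in> \<T> \<Longrightarrow> finite (E t)"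
    using boundary_edges_finite outer_edges tile_edges by blast+
  define l where "l = (\<lambda>(p :: complex, q). (sgn (q - p), cross (sgn (q - p)) p))"
  \<comment> \<open>each line occurs in \<open>\<Lambda>\<close> with both directions, so every edge is counted twice below\<close>
  define \<Lambda> where "\<Lambda> = l ` EE \<union> (\<lambda>(d, h). (- d, - h)) ` l ` EE"
  have fin\<Lambda>: "finite \<Lambda>" unfolding \<Lambda>_def EE_def using fin finite_tiles by auto
  have distinct: "p \<noteq> q" if "(p, q) \<in> EE" for p q
    using that boundary_edges_distinct_ends[OF outer_edges] boundary_edges_distinct_ends[OF tile_edges]
    unfolding EE_def by blast
  have unit: "norm d = 1" if "(d, h) \<in> \<Lambda>" for d h
    using that distinct unfolding \<Lambda>_def l_def by (auto simp: norm_sgn dest: distinct)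
  have edge: "(\<Sum>(d, h)\<in>\<Lambda>. w d h * signed_length d h e) = 2 * weighted_length w e" if e: "e \<in> EE" for e
  proof -
    obtain p q where pq: "e = (p, q)" by (cases e)
    define d h where "d = sgn (q - p)" and "h = cross d p"
    have ne: "q - p \<noteq> 0" using distinct e pq by force
    have nd: "norm d = 1" using ne by (simp add: d_def norm_sgn)
    have in\<Lambda>: "(d, h) \<in> \<Lambda>" "(- d, - h) \<in> \<Lambda>"
      using e unfolding \<Lambda>_def l_def d_def h_def pq by force+
    have dq: "d \<bullet> (q - p) = norm (q - p)"
      using ne by (simp add: d_def sgn_div_norm dot_square_norm power2_eq_square)
    have cr: "cross d (q - p) = 0" by (simp add: d_def sgn_div_norm cross_def)
    have crm: "cross (- d) v = - cross d v" for v by (simp add: cross_def)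
    \<comment> \<open>A unit vector parallel to the edge is its direction or the opposite one, which
      determines the height as well.\<close>
    have z: "signed_length d' h' e = 0" if "(d', h') \<in> \<Lambda> - {(d, h), (- d, - h)}" for d' h'
      using that parallel_unit[OF unit[of d' h'] _ ne] crm
      by (auto simp: signed_length_def pq d_def h_def)
    have "(d, h) \<noteq> (- d, - h)" using nd by (auto simp: eq_neg_iff_add_eq_0)
    moreover have "(\<Sum>(d, h)\<in>\<Lambda>. w d h * signed_length d h e)
        = (\<Sum>(d, h)\<in>{(d, h), (- d, - h)}. w d h * signed_length d h e)"
    proof (rule sum.mono_neutral_right[OF fin\<Lambda>])
      show "\<forall>i\<in>\<Lambda> - {(d, h), (- d, - h)}. (case i of (d, h) \<Rightarrow> w d h * signed_length d h e) = 0"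
        using z by (metis (mono_tags, lifting) case_prod_conv mult_zero_right surj_pair)
    qed (use in\<Lambda> in auto)
    ultimately have "(\<Sum>(d, h)\<in>\<Lambda>. w d h * signed_length d h e)
        = w d h * signed_length d h e + w (- d) (- h) * signed_length (- d) (- h) e" by simp
    also have "\<dots> = 2 * (w d h * norm (q - p))"
      using cr crm dq by (simp add: odd signed_length_def pq h_def)
    finally show ?thesis by (simp add: weighted_length_def pq d_def h_def)
  qed
  have "2 * (\<Sum>t\<in>\<T>. \<Sum>e\<in>E t. weighted_length w e)
      = (\<Sum>t\<in>\<T>. \<Sum>e\<in>E t. \<Sum>(d, h)\<in>\<Lambda>. w d h * signed_length d h e)"
    unfolding sum_distrib_left by (intro sum.cong refl edge[symmetric]) (auto simp: EE_def)
  also have "\<dots> = (\<Sum>t\<in>\<T>. \<Sum>(d, h)\<in>\<Lambda>. \<Sum>e\<in>E t. w d h * signed_length d h e)"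
    unfolding case_prod_unfold by (intro sum.cong refl sum.swap)
  also have "\<dots> = (\<Sum>(d, h)\<in>\<Lambda>. w d h * (\<Sum>t\<in>\<T>. \<Sum>e\<in>E t. signed_length d h e))"
    unfolding case_prod_unfold sum_distrib_left by (rule sum.swap)
  also have "\<dots> = (\<Sum>(d, h)\<in>\<Lambda>. w d h * (\<Sum>e\<in>ED. signed_length d h e))"
    using signed_length_sum unit by (intro sum.cong) auto
  also have "\<dots> = (\<Sum>e\<in>ED. \<Sum>(d, h)\<in>\<Lambda>. w d h * signed_length d h e)"
    unfolding case_prod_unfold sum_distrib_left by (rule sum.swap)
  also have "\<dots> = 2 * (\<Sum>e\<in>ED. weighted_length w e)"
    unfolding sum_distrib_left by (intro sum.cong refl edge) (auto simp: EE_def)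
  finally show ?thesis by simp
qed

end

section \<open>Angles, congruence and additive functions\<close>

lemma inner_squared_plus_cross_squared: "(u \<bullet> v)\<^sup>2 + (cross u v)\<^sup>2 = (norm u)\<^sup>2 * (norm v)\<^sup>2"
  unfolding cmod_power2 cross_def inner_complex_def by algebra

lemma angle_commute: "angle X Y Z = angle Z Y X"
  by (simp add: angle_def inner_commute mult.commute)

text \<open>The law of cosines. It makes angles functions of distances, so that isometries preserve
  them.\<close>

lemma angle_dist:
  "angle X Y Z = arccos (((dist X Y)\<^sup>2 + (dist Z Y)\<^sup>2 - (dist X Z)\<^sup>2) / 2 / (dist X Y * dist Z Y))"
  by (simp add: angle_def dot_norm_neg dist_norm)

text \<open>A form of Heron's formula: the area is determined by distances up to sign, the sign
  being the orientation.\<close>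

lemma side_squared_dist:
  "(side p q r)\<^sup>2 = (dist p q)\<^sup>2 * (dist r p)\<^sup>2 - (((dist p q)\<^sup>2 + (dist r p)\<^sup>2 - (dist q r)\<^sup>2) / 2)\<^sup>2"
proof -
  have "(side p q r)\<^sup>2 = (norm (q - p))\<^sup>2 * (norm (r - p))\<^sup>2 - ((q - p) \<bullet> (r - p))\<^sup>2"
    unfolding side_def using inner_squared_plus_cross_squared[of "q - p" "r - p"] by simp
  then show ?thesis by (simp add: dot_norm_neg dist_norm norm_minus_commute)
qed

lemma cos_sin_angle:
  assumes "side p q r > 0"
  shows "cos (angle q p r) = ((q - p) \<bullet> (r - p)) / (norm (q - p) * norm (r - p))"
    and "sin (angle q p r) = side p q r / (norm (q - p) * norm (r - p))"
    and "0 < angle q p r" "angle q p r < pi"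
proof -
  define n where "n = norm (q - p) * norm (r - p)"
  define k where "k = ((q - p) \<bullet> (r - p)) / n"
  define l where "l = side p q r / n"
  have n: "n > 0" using boundary_edges_distinct[OF assms] by (simp add: n_def)
  have "((q - p) \<bullet> (r - p))\<^sup>2 + (side p q r)\<^sup>2 = n\<^sup>2"
    using inner_squared_plus_cross_squared[of "q - p" "r - p"] by (simp add: n_def side_def power_mult_distrib)
  then have kl: "k\<^sup>2 + l\<^sup>2 = 1" using n by (simp add: k_def l_def power_divide add_divide_distrib[symmetric])
  have l: "l > 0" using n assms by (simp add: l_def)
  have "k\<^sup>2 < 1" using kl l by (smt (verit) zero_less_power)
  then have k: "-1 < k" "k < 1" by (auto simp: abs_square_less_1 abs_less_iff)
  have a: "angle q p r = arccos k" by (simp add: angle_def k_def n_def)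
  show "cos (angle q p r) = ((q - p) \<bullet> (r - p)) / (norm (q - p) * norm (r - p))"
    unfolding a using k by (simp add: cos_arccos k_def n_def)
  have "sin (arccos k) = sqrt (1 - k\<^sup>2)" using k by (simp add: sin_arccos)
  also have "\<dots> = sqrt (l\<^sup>2)" using kl by (metis add_diff_cancel_left')
  finally show "sin (angle q p r) = side p q r / (norm (q - p) * norm (r - p))"
    unfolding a using l assms by (simp add: l_def n_def)
  show "0 < angle q p r" "angle q p r < pi" unfolding a using k arccos_lt_bounded by auto
qed

text \<open>The number \<open>cnj (q - p) * (r - p)\<close> has the inner product as real part and
  \<open>side p q r\<close> as imaginary part, so its argument is the angle; the angle thus acts as
  a counterclockwise rotation.\<close>

lemma sgn_cis_angle:
  assumes "side p q r > 0"
  shows "sgn (r - p) = sgn (q - p) * cis (angle q p r)"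
proof -
  define n where "n = norm (q - p) * norm (r - p)"
  have ne: "q \<noteq> p" "r \<noteq> p" using boundary_edges_distinct[OF assms] by auto
  then have n: "n \<noteq> 0" by (simp add: n_def)
  have "of_real n * cis (angle q p r) = cnj (q - p) * (r - p)"
    using n by (simp add: complex_eq_iff cos_sin_angle[OF assms] n_def[symmetric])
       (simp add: side_def cross_def inner_complex_def algebra_simps)
  then have "(q - p) * (of_real n * cis (angle q p r)) = ((q - p) * cnj (q - p)) * (r - p)" by simp
  also have "(q - p) * cnj (q - p) = (of_real (norm (q - p)))\<^sup>2" by (simp only: complex_norm_square[symmetric] of_real_power)
  finally have eq: "(q - p) * (of_real n * cis (angle q p r)) = (of_real (norm (q - p)))\<^sup>2 * (r - p)" .
  have "sgn v = sgn u * c"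
    if "u * (of_real (norm u * norm v) * c) = (of_real (norm u))\<^sup>2 * v" "u \<noteq> 0" "v \<noteq> 0" for u v c :: complex
    using that by (simp add: sgn_div_norm scaleR_conv_of_real power2_eq_square field_simps)
  from this[OF eq[unfolded n_def]] ne show ?thesis by simp
qed

text \<open>Composing the rotations at the three corners reverses a direction, so the sum is an odd
  multiple of \<open>pi\<close>. As it lies strictly between 0 and \<open>3 * pi\<close>, it equals
  \<open>pi\<close>.\<close>

lemma angle_sum_triangle:
  assumes "side p q r > 0"
  shows "angle q p r + angle r q p + angle p r q = pi"
proof -
  define x y z where "x = sgn (q - p)" and "y = sgn (r - q)" and "z = sgn (p - r)"
  define A B C where "A = angle q p r" and "B = angle r q p" and "C = angle p r q"
  have s: "side q r p > 0" "side r p q > 0" using assms by (simp_all add: side_cycle_pos)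
  have m: "sgn (a - b) = - sgn (b - a)" for a b :: complex
    using sgn_minus[of "b - a"] by simp
  have x: "x * cis A = - z" and y: "y * cis B = - x" and z: "z * cis C = - y"
    using sgn_cis_angle[OF assms] sgn_cis_angle[OF s(1)] sgn_cis_angle[OF s(2)]
    unfolding x_def y_def z_def A_def B_def C_def m[of r p] m[of p q] m[of q r] by simp_all
  have "z * (cis C * cis B * cis A) = ((z * cis C) * cis B) * cis A" by (simp add: mult.assoc)
  also have "\<dots> = - z" by (simp add: x y z)
  finally have "z * (cis C * cis B * cis A) = z * (- 1)" by simp
  moreover have "z \<noteq> 0" using boundary_edges_distinct[OF assms] by (simp add: z_def sgn_zero_iff)
  ultimately have "cis C * cis B * cis A = - 1" using mult_left_cancel by blast
  then have "cis (A + B + C) = - 1" by (simp add: cis_mult algebra_simps)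
  then have "cos (A + B + C) = - 1" by (simp add: complex_eq_iff)
  then obtain k :: int where k: "A + B + C = (2 * k + 1) * pi" using cos_eq_minus1 by auto
  have "0 < A + B + C" "A + B + C < 3 * pi"
    using cos_sin_angle(3,4)[OF assms] cos_sin_angle(3,4)[OF s(1)] cos_sin_angle(3,4)[OF s(2)]
    unfolding A_def B_def C_def by linarith+
  then have "0 < real_of_int (2 * k + 1)" "real_of_int (2 * k + 1) < 3"
    using k pi_gt_zero by (simp_all add: zero_less_mult_iff)
  then have "k = 0" by linarith
  then show ?thesis using k by (simp add: A_def B_def C_def)
qed

section \<open>Orientation and congruent triangles\<close>

lemma is_triangle_side:
  assumes "is_triangle U V W"
  shows "side U V W \<noteq> 0"
proof
  assume 0: "side U V W = 0"
  have "collinear {0, V - U, W - U}"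
  proof (cases "V = U")
    case False
    define k where "k = ((V - U) \<bullet> (W - U)) / (norm (V - U))\<^sup>2"
    have n: "(norm (V - U))\<^sup>2 \<noteq> 0" using False by simp
    \<comment> \<open>Expansion of \<open>W - U\<close> in the orthogonal frame
      \<open>V - U\<close>, \<open>\<i> * (V - U)\<close>; the second coefficient is the oriented
      area.\<close>
    have "(norm (V - U))\<^sup>2 *\<^sub>R (W - U) = ((V - U) \<bullet> (W - U)) *\<^sub>R (V - U)
           + side U V W *\<^sub>R (\<i> * (V - U))"
      unfolding cmod_power2 side_def
      by (simp add: complex_eq_iff cross_def inner_complex_def power2_eq_square algebra_simps)
    then have "inverse ((norm (V - U))\<^sup>2) *\<^sub>R ((norm (V - U))\<^sup>2 *\<^sub>R (W - U)) = k *\<^sub>R (V - U)"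
      using 0 by (simp add: k_def divide_inverse_commute)
    then have "W - U = k *\<^sub>R (V - U)" using n by simp
    then show ?thesis unfolding collinear_lemma by blast
  qed (simp add: collinear_lemma)
  then have "collinear {V, U, W}" using collinear_3[of V U W] by (cases "V = 0") (simp_all add: insert_commute)
  then show False using assms by (simp add: is_triangle_def insert_commute)
qed

lemma solid_triangle_commute: "solid_triangle p q r = solid_triangle p r q"
  by (simp add: solid_triangle_def insert_commute)

lemma side_commute: "side p r q = - side p q r"
  by (simp add: side_def cross_def algebra_simps)

text \<open>An isometry is a translation after a linear map, so it carries the hull to the hull of
  the images. If it leaves these clockwise, two vertices are exchanged; hence only data symmetric in
  the vertices are recorded.\<close>

lemma congruent_solid_triangle:
  assumes tri: "is_triangle U V W" and "congruent_sets (solid_triangle U V W) t"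
  obtains p q r where "t = solid_triangle p q r" "side p q r > 0"
    "side p q r = \<bar>side U V W\<bar>"
    "dist p q + dist q r + dist r p = dist U V + dist V W + dist W U"
    "{angle q p r, angle r q p, angle p r q} = {angle V U W, angle W V U, angle U W V}"
proof -
  obtain f where iso: "\<And>x y. dist (f x) (f y) = dist x y" and t: "f ` solid_triangle U V W = t"
    using assms(2) unfolding congruent_sets_def by blast
  define g where "g x = f x - f 0" for x
  have "linear g" by (rule isometry_linear) (simp_all add: g_def dist_norm iso[unfolded dist_norm])
  have fg: "f ` S = (+) (f 0) ` (g ` S)" for S by (simp add: g_def image_image)
  have img: "solid_triangle (f U) (f V) (f W) = t"
  proof -
    have "{f U, f V, f W} = (+) (f 0) ` (g ` {U, V, W})" by (simp add: g_def)
    then show ?thesis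
      unfolding t[symmetric] solid_triangle_def fg
      by (simp only: convex_hull_linear_image[OF \<open>linear g\<close>] convex_hull_translation)
  qed
  have side: "side (f U) (f V) (f W) = side U V W \<or> side (f U) (f V) (f W) = - side U V W"
    using side_squared_dist[of "f U" "f V" "f W"] side_squared_dist[of U V W]
    unfolding iso by (metis power2_eq_iff)
  have ang: "angle (f X) (f Y) (f Z) = angle X Y Z" for X Y Z
    unfolding angle_dist iso ..
  show thesis
  proof (cases "side (f U) (f V) (f W) > 0")
    case True
    then show ?thesis
      using side by (intro that[of "f U" "f V" "f W"]) (auto simp: img iso ang)
  next
    case False
    then have pos: "side (f U) (f W) (f V) > 0"
      using side is_triangle_side[OF tri] side_commute[of "f U" "f W" "f V"] by auto
    show ?thesis
    proof (rule that[of "f U" "f W" "f V"])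
      show "side (f U) (f W) (f V) = \<bar>side U V W\<bar>"
        using side pos side_commute[of "f U" "f W" "f V"] by linarith
    qed (use pos img solid_triangle_commute in \<open>auto simp: iso ang dist_commute angle_commute\<close>)
  qed
qed

text \<open>Over the rationals \<open>x\<close> and \<open>y\<close> are linearly independent, so a
  linear map on the reals can take prescribed values at both.\<close>

lemma additive_extension:
  fixes x y :: real
  assumes "x \<noteq> 0" "y / x \<notin> \<rat>"
  obtains \<rho> :: "real \<Rightarrow> real" where "\<And>u v. \<rho> (u + v) = \<rho> u + \<rho> v"
    "\<And>k u. \<rho> (of_int k * u) = of_int k * \<rho> u" "\<rho> x = 1" "\<rho> y = 1"
proof -
  let ?s = "\<lambda>(q :: rat) (u :: real). of_rat q * u"
  interpret Q: vector_space ?s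
    by unfold_locales (simp_all add: of_rat_add of_rat_mult algebra_simps)
  interpret Q2: vector_space_pair ?s ?s ..
  have "y \<notin> Q.span {x}"
  proof
    assume "y \<in> Q.span {x}"
    then obtain q where "y = of_rat q * x" by (auto simp: Q.span_singleton)
    then show False using assms by auto
  qed
  then have "Q.independent {y, x}"
    using assms(1) by (simp add: Q.independent_insert)
  then obtain \<rho> where lin: "Vector_Spaces.linear ?s ?s \<rho>" and v: "\<forall>u\<in>{y, x}. \<rho> u = 1"
    using Q2.linear_independent_extend[of "{y, x}" "\<lambda>_. 1"] by blast
  interpret l: Vector_Spaces.linear ?s ?s \<rho> by (rule lin)
  show thesis
  proof
    show "\<rho> (u + v) = \<rho> u + \<rho> v" for u v by (rule l.add)
    show "\<rho> (of_int k * u) = of_int k * \<rho> u" for k u using l.scale[of "of_int k" u] by simp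
  qed (use v in auto)
qed

section \<open>Adjacency of tiles\<close>

lemma boundary_edges_convex:
  assumes "boundary_edges t E"
  shows "convex t" "compact t" "interior t \<noteq> {}"
proof -
  obtain p q r where t: "t = solid_triangle p q r" and pos: "side p q r > 0"
    using assms unfolding boundary_edges_def by blast
  show "convex t" "compact t" unfolding t solid_triangle_def
    by (simp_all add: finite_imp_compact_convex_hull)
  \<comment> \<open>The centroid, at which all three edge functions are positive.\<close>
  let ?m = "(1/3) *\<^sub>R p + (1/3) *\<^sub>R q + (1/3) *\<^sub>R r"
  have "?m \<in> interior t" unfolding t
  proof (rule interior_solid_triangleI[OF pos])
    have s: "side q r p > 0" "side r p q > 0" using pos by (simp_all add: side_cycle_pos)
    show "side p q ?m > 0" "side q r ?m > 0" "side r p ?m > 0"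
      using pos s by (simp_all add: side_convex3)
  qed
  then show "interior t \<noteq> {}" by blast
qed

lemma sgn_parallel_unit:
  assumes "norm d = 1" "cross d u = 0" "u \<noteq> 0"
  shows "sgn u = sgn (d \<bullet> u) *\<^sub>R d" "d \<bullet> u \<noteq> 0"
  using parallel_unit[OF assms] assms(3) by auto

text \<open>A point of the triangle outside its interior annihilates some edge function; by
  genericity that edge is parallel to \<open>d\<close>, and the other two functions are positive at
  \<open>z\<close>. A small step to the left of the edge then leads into the interior.\<close>

lemma edge_at_frontier:
  assumes t: "boundary_edges t E" and d: "norm d = 1" and gen: "generic d z E"
    and z: "z \<in> t" "z \<notin> interior t"
  obtains p q where "(p, q) \<in> E" "cross d (q - p) = 0" "d \<bullet> (q - p) \<noteq> 0"
    "\<forall>\<^sub>F e in at_right 0. z + of_real (sgn (d \<bullet> (q - p)) * e) * \<i> * d \<in> interior t"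
proof -
  have nonneg: "\<forall>(p, q)\<in>E. side p q z \<ge> 0" using boundary_edges_mem_iff[OF t] z(1) by blast
  have "\<not> (\<forall>(p, q)\<in>E. side p q z > 0)" using boundary_edges_interiorI[OF t] z(2) by blast
  with nonneg obtain p q where pq: "(p, q) \<in> E" and 0: "side p q z = 0" by force
  obtain r where tri: "t = solid_triangle p q r" and pos: "side p q r > 0"
    and E: "E = {(p, q), (q, r), (r, p)}"
    using boundary_edges_rotate[OF t pq] by metis
  have par: "cross d (v - u) = 0" if "(u, v) \<in> E" "side u v z = 0" for u v
    using gen that unfolding generic_def by auto
  have d0: "d \<noteq> 0" using d by auto
  have "cross (q - p) (r - q) \<noteq> 0" "cross (q - p) (p - r) \<noteq> 0"
    using pos by (auto simp: side_def cross_def algebra_simps)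
  then have "side q r z \<noteq> 0" "side r p z \<noteq> 0"
    using par[OF pq 0] par[of q r] par[of r p] cross_parallel[OF _ _ d0] E by auto
  then have s: "side q r z > 0" "side r p z > 0" using nonneg E by auto
  define k where "k = d \<bullet> (q - p)"
  have k: "k \<noteq> 0" using sgn_parallel_unit(2)[OF d par[OF pq 0]] boundary_edges_distinct[OF pos]
    by (simp add: k_def)
  have shift: "side u v (z + of_real (sgn k * e) * \<i> * d) = side u v z + e * (sgn k * (d \<bullet> (v - u)))" for u v e
    by (simp only: side_normal) simp
  have "\<forall>\<^sub>F e in at_right 0. (e::real) > 0" by (simp add: eventually_at_right_less)
  moreover have "\<forall>\<^sub>F e in at_right 0. sgn (side q r (z + of_real (sgn k * e) * \<i> * d)) = 1"
    unfolding shift using eventually_sgn_perturb[of "side q r z" "sgn k * (d \<bullet> (r - q))"] s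
    by (auto elim: eventually_mono)
  moreover have "\<forall>\<^sub>F e in at_right 0. sgn (side r p (z + of_real (sgn k * e) * \<i> * d)) = 1"
    unfolding shift using eventually_sgn_perturb[of "side r p z" "sgn k * (d \<bullet> (p - r))"] s
    by (auto elim: eventually_mono)
  ultimately have "\<forall>\<^sub>F e in at_right 0. z + of_real (sgn k * e) * \<i> * d \<in> interior t"
  proof eventually_elim
    case (elim e)
    have "side p q (z + of_real (sgn k * e) * \<i> * d) = e * \<bar>k\<bar>"
      unfolding shift 0 by (simp add: k_def[symmetric] abs_sgn mult.commute)
    then show ?case unfolding tri
      using elim k by (intro interior_solid_triangleI[OF pos]) (auto simp: sgn_1_pos)
  qed
  then show thesis using that[OF pq par[OF pq 0]] k unfolding k_def by blast
qed

context dissection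
begin

text \<open>At a generic point of the segment both tiles have an edge along it. Were these directed
  alike, both tiles would lie on the same side there and their interiors would meet.\<close>

lemma shared_segment_opposite_edges:
  assumes st: "s \<in> \<T>" "t \<in> \<T>" "s \<noteq> t" and "share_segment s t"
  obtains p q p' q' where "(p, q) \<in> E s" "(p', q') \<in> E t" "sgn (q' - p') = - sgn (q - p)"
proof -
  obtain x y where xy: "x \<noteq> y" "closed_segment x y \<subseteq> frontier s \<inter> frontier t"
    using assms(4) unfolding share_segment_def by blast
  define d where "d = sgn (y - x)"
  define h where "h = cross d x"
  have d: "norm d = 1" using xy by (simp add: d_def norm_sgn)
  let ?B = "{u. \<not> generic d (line_point d h u) (E s)} \<union> {u. \<not> generic d (line_point d h u) (E t)}"
  have "finite ?B" using finite_nongeneric boundary_edges_finite tile_edges st by blast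
  moreover have "infinite {d \<bullet> x<..<d \<bullet> x + norm (y - x)}" using xy by simp
  ultimately obtain u where u: "u \<in> {d \<bullet> x<..<d \<bullet> x + norm (y - x)}" "u \<notin> ?B"
    by (meson finite_subset subsetI)
  define z where "z = line_point d h u"
  have gen: "generic d z (E s)" "generic d z (E t)" using u by (auto simp: z_def)
  define v where "v = (u - d \<bullet> x) / norm (y - x)"
  have v: "0 \<le> v" "v \<le> 1" using u xy by (auto simp: v_def field_simps)
  have "z = line_point d h (d \<bullet> x) + (u - d \<bullet> x) *\<^sub>R d"
    by (simp add: z_def line_point_def scaleR_conv_of_real algebra_simps)
  also have "line_point d h (d \<bullet> x) = x" unfolding h_def by (rule line_point_inner[OF d])
  also have "(u - d \<bullet> x) *\<^sub>R d = v *\<^sub>R (y - x)"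
    by (simp add: v_def d_def sgn_div_norm divide_inverse)
  finally have "z \<in> closed_segment x y" using v by (auto simp: in_segment algebra_simps)
  then have "z \<in> frontier s" "z \<in> frontier t" using xy by auto
  moreover have "closed s" "closed t"
    using boundary_edges_convex(2) tile_edges st compact_imp_closed by blast+
  ultimately have z: "z \<in> s" "z \<notin> interior s" "z \<in> t" "z \<notin> interior t"
    by (auto simp: frontier_def)
  obtain p q where pq: "(p, q) \<in> E s" "cross d (q - p) = 0" "d \<bullet> (q - p) \<noteq> 0"
    "\<forall>\<^sub>F e in at_right 0. z + of_real (sgn (d \<bullet> (q - p)) * e) * \<i> * d \<in> interior s"
    using edge_at_frontier[OF tile_edges[OF st(1)] d gen(1) z(1,2)] .
  obtain p' q' where pq': "(p', q') \<in> E t" "cross d (q' - p') = 0" "d \<bullet> (q' - p') \<noteq> 0"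
    "\<forall>\<^sub>F e in at_right 0. z + of_real (sgn (d \<bullet> (q' - p')) * e) * \<i> * d \<in> interior t"
    using edge_at_frontier[OF tile_edges[OF st(2)] d gen(2) z(3,4)] .
  have "sgn (d \<bullet> (q - p)) \<noteq> sgn (d \<bullet> (q' - p'))"
  proof
    assume "sgn (d \<bullet> (q - p)) = sgn (d \<bullet> (q' - p'))"
    then have "\<forall>\<^sub>F e in at_right 0. z + of_real (sgn (d \<bullet> (q - p)) * e) * \<i> * d \<in> interior t"
      using pq'(4) by simp
    with pq(4) have "\<forall>\<^sub>F e in at_right (0::real). False"
      by eventually_elim (use tiles_disjoint[OF st] in blast)
    then show False by (simp add: eventually_const_iff)
  qed
  then have "sgn (d \<bullet> (q' - p')) = - sgn (d \<bullet> (q - p))"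
    using pq(3) pq'(3) by (auto simp: sgn_if split: if_splits)
  moreover have "q - p \<noteq> 0" "q' - p' \<noteq> 0" using pq(3) pq'(3) by auto
  ultimately have "sgn (q' - p') = - sgn (q - p)"
    using sgn_parallel_unit(1)[OF d pq(2)] sgn_parallel_unit(1)[OF d pq'(2)] by simp
  then show thesis using that pq(1) pq'(1) by blast
qed

text \<open>A convex set with interior points lies in the closure of its interior. A point of
  \<open>v\<close> interior to \<open>u\<close> would thus have interior points of \<open>v\<close>
  nearby, and these would be interior to both.\<close>

lemma tiles_meet_in_frontiers:
  assumes st: "s \<in> \<T>" "t \<in> \<T>" "s \<noteq> t"
  shows "s \<inter> t \<subseteq> frontier s \<inter> frontier t"
proof -
  have *: "x \<notin> interior u" if "u \<in> \<T>" "v \<in> \<T>" "u \<noteq> v" "x \<in> v" for u v x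
  proof
    assume "x \<in> interior u"
    moreover have "x \<in> closure (interior v)"
      using that convex_closure_interior[of v] boundary_edges_convex[OF tile_edges[of v]]
        closure_subset by blast
    ultimately have "interior u \<inter> interior v \<noteq> {}"
      using open_Int_closure_eq_empty[of "interior u" "interior v"] by blast
    then show False using tiles_disjoint that by blast
  qed
  show ?thesis using *[OF st] *[OF st(2,1)] st(3) closure_subset by (fastforce simp: frontier_def)
qed

text \<open>Serves the uniqueness of the colouring: the tiles on which two colourings agree form a
  set closed under adjacency.\<close>

lemma adjacency_connected:
  assumes S: "S \<subseteq> \<T>" "S \<noteq> {}"
    and closed_adj: "\<And>s t. s \<in> S \<Longrightarrow> t \<in> \<T> \<Longrightarrow> s \<noteq> t \<Longrightarrow> share_segment s t \<Longrightarrow> t \<in> S"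
  shows "S = \<T>"
proof (rule ccontr)
  assume "S \<noteq> \<T>"
  define R where "R = \<T> - S"
  have R: "R \<subseteq> \<T>" "R \<noteq> {}" using S \<open>S \<noteq> \<T>\<close> by (auto simp: R_def)
  \<comment> \<open>two convex tiles sharing no segment meet in at most one point, and deleting finitely many
    points leaves the interior of \<open>D\<close> connected\<close>
  define F where "F = (\<Union>s\<in>S. \<Union>t\<in>R. s \<inter> t)"
  have finSR: "finite S" "finite R" using finite_tiles S R finite_subset by blast+
  have "finite (s \<inter> t)" if "s \<in> S" "t \<in> R" for s t
  proof -
    have st: "s \<in> \<T>" "t \<in> \<T>" "s \<noteq> t" using that S by (auto simp: R_def)
    have "x = y" if "x \<in> s \<inter> t" "y \<in> s \<inter> t" for x y
    proof (rule ccontr)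
      assume "x \<noteq> y"
      have "convex (s \<inter> t)"
        using boundary_edges_convex(1)[OF tile_edges] st by (intro convex_Int) auto
      then have "closed_segment x y \<subseteq> s \<inter> t" using that by (intro closed_segment_subset)
      then have "share_segment s t"
        using tiles_meet_in_frontiers[OF st] \<open>x \<noteq> y\<close> unfolding share_segment_def by blast
      then show False using closed_adj[OF \<open>s \<in> S\<close> st(2,3)] \<open>t \<in> R\<close> by (simp add: R_def)
    qed
    then have "s \<inter> t = {} \<or> (\<exists>x. s \<inter> t = {x})" by blast
    then show ?thesis by auto
  qed
  then have finF: "finite F" unfolding F_def using finSR by blast
  have cl: "closed (\<Union>S)" "closed (\<Union>R)"
    using finSR S(1) R(1) boundary_edges_convex(2)[OF tile_edges]
    by (auto intro!: closed_Union compact_imp_closed)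
  have "connected (interior D - F)"
    using boundary_edges_convex(1)[OF outer_edges] finF
    by (intro connected_open_diff_countable) (auto simp: convex_connected convex_interior countable_finite)
  moreover have "interior D - F \<subseteq> \<Union>S \<union> \<Union>R"
    using tiles_Union interior_subset[of D] by (auto simp: R_def)
  moreover have "\<Union>S \<inter> \<Union>R \<inter> (interior D - F) = {}" by (auto simp: F_def)
  ultimately have "\<Union>S \<inter> (interior D - F) = {} \<or> \<Union>R \<inter> (interior D - F) = {}"
    using cl unfolding connected_closed by blast
  \<comment> \<open>The interior of a tile is a nonempty open set, hence infinite and not contained
    in \<open>F\<close>; so neither half of the separation is empty.\<close>
  moreover have "\<Union>P \<inter> (interior D - F) \<noteq> {}" if P: "P \<subseteq> \<T>" "P \<noteq> {}" for P
  proof -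
    obtain t where t: "t \<in> P" "t \<in> \<T>" using P by auto
    have "interior t \<noteq> {}" using boundary_edges_convex(3)[OF tile_edges[OF t(2)]] .
    then have "infinite (interior t)" by (metis finite_imp_not_open open_interior)
    then obtain x where x: "x \<in> interior t" "x \<notin> F" using finF by (meson finite_subset subsetI)
    have "t \<subseteq> D" using t tiles_Union by auto
    then have "x \<in> interior D" using x(1) interior_mono by blast
    then show ?thesis using x t interior_subset[of t] by auto
  qed
  ultimately show False using S R by blast
qed

end

section \<open>Tiles at a corner\<close>

lemma side_add_scaleR: "side p q (x + of_real e * d) = side p q x + e * cross (q - p) d"
  by (simp add: side_def cross_def algebra_simps)

text \<open>Moving from \<open>x\<close> along \<open>d\<close>, the function of an edge not
  parallel to \<open>d\<close> has nonzero slope, so it does not vanish for small positive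
  \<open>e\<close>.\<close>

lemma eventually_generic:
  assumes "finite E"
  shows "\<forall>\<^sub>F e in at_right 0. generic d (x + of_real e * d) E"
proof -
  have "\<forall>\<^sub>F e in at_right 0. cross d (q - p) \<noteq> 0 \<longrightarrow> side p q (x + of_real e * d) \<noteq> 0" for p q
  proof (cases "cross d (q - p) = 0")
    case False
    then have "cross (q - p) d \<noteq> 0" by (simp add: cross_def algebra_simps)
    then show ?thesis unfolding side_add_scaleR
      using eventually_sgn_perturb[of "side p q x" "cross (q - p) d"]
      by (auto elim!: eventually_mono simp: sgn_if split: if_splits)
  qed simp
  then have "\<forall>\<^sub>F e in at_right 0. \<forall>a\<in>E. case a of (p, q) \<Rightarrow>
      cross d (q - p) \<noteq> 0 \<longrightarrow> side p q (x + of_real e * d) \<noteq> 0"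
    by (intro eventually_ball_finite assms) auto
  then show ?thesis by (simp add: generic_def)
qed

lemma eventually_jump_ray:
  assumes d: "norm d = 1" and "q \<noteq> A"
  shows "\<forall>\<^sub>F e in at_right 0. jump d (A + of_real e * d) (A, q) = of_bool (d = sgn (q - A))"
proof (cases "d = sgn (q - A)")
  case True
  have n: "norm (q - A) > 0" using assms by simp
  have "\<forall>\<^sub>F e in at_right (0::real). e \<in> {0<..<norm (q - A)}"
    using eventually_at_right_real[OF n] .
  then show ?thesis
  proof eventually_elim
    case (elim e)
    define u where "u = e / norm (q - A)"
    have u: "0 < u" "u < 1" using elim n by (auto simp: u_def simp del: zero_less_norm_iff)
    have "of_real e * d = u *\<^sub>R (q - A)"
      by (simp add: True u_def sgn_div_norm scaleR_conv_of_real divide_inverse)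
    then have "A + of_real e * d = (1 - u) *\<^sub>R A + u *\<^sub>R q" by (simp add: algebra_simps)
    then have "A + of_real e * d \<in> open_segment A q" using u assms(2) by (auto simp: in_segment)
    moreover have "cross d (q - A) = 0" by (simp add: True sgn_div_norm cross_def)
    moreover have "d \<bullet> (q - A) > 0" using n by (simp add: True sgn_div_norm dot_square_norm)
    ultimately show ?case using True by (simp add: jump_def)
  qed
next
  case False
  have "\<forall>\<^sub>F e in at_right (0::real). e > 0" by (simp add: eventually_at_right_less)
  then show ?thesis
  proof eventually_elim
    case (elim e)
    have "A + of_real e * d \<notin> open_segment A q"
    proof
      assume "A + of_real e * d \<in> open_segment A q"
      then obtain u where u: "0 < u" "A + of_real e * d = (1 - u) *\<^sub>R A + u *\<^sub>R q" by (auto simp: in_segment)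
      then have "e *\<^sub>R d = u *\<^sub>R (q - A)" by (simp add: algebra_simps scaleR_conv_of_real)
      then have "sgn (e *\<^sub>R d) = sgn (u *\<^sub>R (q - A))" by simp
      then show False using u(1) elim False d by (simp add: sgn_scaleR sgn_div_norm[of d])
    qed
    then show ?case using False by (simp add: jump_def)
  qed
qed

lemma jump_reverse: "jump d x (q, p) = - jump d x (p, q)"
proof -
  have "cross d (p - q) = - cross d (q - p)" "d \<bullet> (p - q) = - (d \<bullet> (q - p))"
    by (simp_all add: cross_def inner_diff_right algebra_simps)
  then show ?thesis by (simp add: jump_def open_segment_commute sgn_minus)
qed

text \<open>Close to \<open>A\<close> the opposite edge is out of reach. The edge leaving
  \<open>A\<close> counts positively and the edge entering \<open>A\<close> negatively.\<close>

lemma eventually_jump_vertex: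
  assumes d: "norm d = 1" and pos: "side A q r > 0"
  shows "\<forall>\<^sub>F e in at_right 0. (\<Sum>a\<in>{(A, q), (q, r), (r, A)}. jump d (A + of_real e * d) a)
      = of_bool (d = sgn (q - A)) - of_bool (d = sgn (r - A))"
proof -
  have ne: "q \<noteq> A" "r \<noteq> A" using boundary_edges_distinct[OF pos] by auto
  have "side q r A > 0" using pos by (simp add: side_cycle_pos)
  then have "\<forall>\<^sub>F e in at_right 0. side q r (A + of_real e * d) \<noteq> 0"
    unfolding side_add_scaleR using eventually_sgn_perturb[of "side q r A" "cross (r - q) d"]
    by (auto elim!: eventually_mono simp: sgn_if split: if_splits)
  with eventually_jump_ray[OF d ne(1)] eventually_jump_ray[OF d ne(2)]
  show ?thesis
  proof eventually_elim
    case (elim e)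
    have "side q r A > 0" using pos by (simp add: side_cycle_pos)
    then have "jump d (A + of_real e * d) (q, r) = 0"
      using elim(3) open_segment_side[of q r A] by (simp add: jump_def)
    then show ?case unfolding boundary_edges_sum[OF pos] jump_reverse[of d _ r A]
      using elim(1,2) by simp
  qed
qed

lemma edge_subset_tile:
  assumes "boundary_edges t E" "(p, q) \<in> E"
  shows "open_segment p q \<subseteq> t"
proof -
  obtain r where "t = solid_triangle p q r" using boundary_edges_rotate[OF assms] by metis
  then have "p \<in> t" "q \<in> t" "convex t" by (auto simp: solid_triangle_def hull_inc)
  then show ?thesis using closed_segment_subset[of p t q] segment_open_subset_closed[of p q] by blast
qed

text \<open>The corner \<open>A\<close> is an extreme point: the affine function \<open>l\<close> is
  nonnegative on the big triangle and vanishes only at \<open>A\<close>. Writing \<open>A\<close> as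
  a convex combination of the vertices of \<open>t\<close> forces \<open>l\<close> to vanish at a
  vertex of positive weight.\<close>

lemma vertex_of_subtriangle:
  assumes D: "side A B C > 0" and t: "boundary_edges t E" "t \<subseteq> solid_triangle A B C" "A \<in> t"
  obtains q r where "t = solid_triangle A q r" "side A q r > 0" "E = {(A, q), (q, r), (r, A)}"
proof -
  obtain p q r where tri: "t = solid_triangle p q r" and E: "E = {(p, q), (q, r), (r, p)}"
    using t(1) unfolding boundary_edges_def by blast
  define l where "l z = side A B z + side C A z" for z
  have l0: "l z \<ge> 0 \<and> (l z = 0 \<longrightarrow> z = A)" if "z \<in> t" for z
  proof -
    have z: "side A B z \<ge> 0" "side C A z \<ge> 0" using that t(2) mem_solid_triangle_iff[OF D] by auto
    have "z = A" if "side A B z = 0" "side C A z = 0"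
      using barycentric[of A B C z] D side_sum[of A B z C] that by simp
    then show ?thesis using z by (auto simp: l_def add_nonneg_eq_0_iff)
  qed
  obtain u v w where uvw: "u \<ge> 0" "v \<ge> 0" "w \<ge> 0" "u + v + w = 1"
    and A: "A = u *\<^sub>R p + v *\<^sub>R q + w *\<^sub>R r"
    using t(3) unfolding tri solid_triangle_def convex_hull_3 mem_Collect_eq by metis
  have in_t: "p \<in> t" "q \<in> t" "r \<in> t" by (simp_all add: tri solid_triangle_def hull_inc)
  have "l (u *\<^sub>R p + v *\<^sub>R q + w *\<^sub>R r) = u * l p + v * l q + w * l r"
    unfolding l_def side_convex3[OF uvw(4)] by (simp add: algebra_simps)
  moreover have "l A = 0" by (simp add: l_def)
  ultimately have "u * l p + v * l q + w * l r = 0" using A by simp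
  moreover have "u * l p \<ge> 0" "v * l q \<ge> 0" "w * l r \<ge> 0" using l0 in_t uvw by auto
  ultimately have "u * l p = 0" "v * l q = 0" "w * l r = 0" by linarith+
  moreover have "u \<noteq> 0 \<or> v \<noteq> 0 \<or> w \<noteq> 0" using uvw(4) by auto
  ultimately have "l p = 0 \<or> l q = 0 \<or> l r = 0" by auto
  then have "A = p \<or> A = q \<or> A = r" using l0 in_t by blast
  then obtain q' where "(A, q') \<in> E" unfolding E by blast
  then show thesis using boundary_edges_rotate[OF t(1)] that by metis
qed

text \<open>The first claim is \<open>jump_sum\<close> at points near \<open>A\<close> on the ray in
  direction \<open>d\<close>. Weighting it with \<open>g d\<close> and summing over directions gives
  the second, in which edges shared by neighbouring tiles at \<open>A\<close> telescope.\<close>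

lemma (in dissection) vertex_edge_directions:
  fixes g :: "complex \<Rightarrow> real"
  assumes D: "D = solid_triangle A B C" "side A B C > 0" "ED = {(A, B), (B, C), (C, A)}"
    and t: "\<And>t. t \<in> \<T> \<Longrightarrow> A \<in> t \<Longrightarrow> side A (q t) (r t) > 0 \<and> E t = {(A, q t), (q t, r t), (r t, A)}"
  shows "norm d = 1 \<Longrightarrow> (\<Sum>t | t \<in> \<T> \<and> A \<in> t. of_bool (d = sgn (q t - A)) - of_bool (d = sgn (r t - A)))
      = of_bool (d = sgn (B - A)) - (of_bool (d = sgn (C - A)) :: real)"
    and "(\<Sum>t | t \<in> \<T> \<and> A \<in> t. g (sgn (q t - A)) - g (sgn (r t - A))) = g (sgn (B - A)) - g (sgn (C - A))"
proof -
  let ?TA = "{t. t \<in> \<T> \<and> A \<in> t}"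
  have fin: "finite ?TA" using finite_tiles by simp
  have *: "(\<Sum>t\<in>?TA. of_bool (d = sgn (q t - A)) - of_bool (d = sgn (r t - A)))
      = of_bool (d = sgn (B - A)) - (of_bool (d = sgn (C - A)) :: real)" if d: "norm d = 1" for d
  proof -
    have d0: "d \<noteq> 0" using d by auto
    \<comment> \<open>Tiles are closed, so one that misses \<open>A\<close> also misses all points
      close to \<open>A\<close>.\<close>
    have away: "\<forall>\<^sub>F e in at_right 0. (\<Sum>a\<in>E t. jump d (A + of_real e * d) a) = 0" if "t \<in> \<T>" "A \<notin> t" for t
    proof -
      have "open (- t)"
        using boundary_edges_convex(2)[OF tile_edges[OF that(1)]] by (simp add: compact_imp_closed open_Compl)
      moreover have "((\<lambda>e. A + of_real e * d) \<longlongrightarrow> A + of_real 0 * d) (at_right 0)"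
        by (intro tendsto_intros)
      ultimately have "\<forall>\<^sub>F e in at_right 0. A + of_real e * d \<in> - t"
        using that(2) by (intro topological_tendstoD) auto
      then show ?thesis
      proof eventually_elim
        case (elim e)
        have "jump d (A + of_real e * d) a = 0" if "a \<in> E t" for a
          using elim edge_subset_tile[OF tile_edges[OF \<open>t \<in> \<T>\<close>], of "fst a" "snd a"] that
          by (cases a) (auto simp: jump_def)
        then show ?case by simp
      qed
    qed
    have near: "\<forall>\<^sub>F e in at_right 0. (\<Sum>a\<in>E t. jump d (A + of_real e * d) a)
        = of_bool (d = sgn (q t - A)) - of_bool (d = sgn (r t - A))" if "t \<in> \<T>" "A \<in> t" for t
      using eventually_jump_vertex[OF d, of A "q t" "r t"] t[OF that] by simp
    have "\<forall>\<^sub>F e in at_right 0. \<forall>t\<in>\<T>. (\<Sum>a\<in>E t. jump d (A + of_real e * d) a)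
        = (if A \<in> t then of_bool (d = sgn (q t - A)) - of_bool (d = sgn (r t - A)) else 0)"
      using near away by (intro eventually_ball_finite finite_tiles) auto
    moreover have "\<forall>\<^sub>F e in at_right 0. \<forall>t\<in>\<T>. generic d (A + of_real e * d) (E t)"
      using boundary_edges_finite[OF tile_edges] by (intro eventually_ball_finite finite_tiles) (auto intro: eventually_generic)
    moreover have "\<forall>\<^sub>F e in at_right 0. generic d (A + of_real e * d) ED"
      using boundary_edges_finite[OF outer_edges] by (rule eventually_generic)
    moreover have "\<forall>\<^sub>F e in at_right 0. (\<Sum>a\<in>ED. jump d (A + of_real e * d) a)
        = of_bool (d = sgn (B - A)) - of_bool (d = sgn (C - A))"
      unfolding D(3) by (rule eventually_jump_vertex[OF d D(2)])
    ultimately have "\<forall>\<^sub>F e in at_right (0::real). ?thesis"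
    proof eventually_elim
      case (elim e)
      have "(\<Sum>t\<in>?TA. of_bool (d = sgn (q t - A)) - of_bool (d = sgn (r t - A)))
          = (\<Sum>t\<in>\<T>. if A \<in> t then of_bool (d = sgn (q t - A)) - of_bool (d = sgn (r t - A)) else (0::real))"
        using finite_tiles by (intro sum.mono_neutral_cong_left) auto
      also have "\<dots> = (\<Sum>t\<in>\<T>. \<Sum>a\<in>E t. jump d (A + of_real e * d) a)"
        using elim(1) by (intro sum.cong) auto
      also have "\<dots> = (\<Sum>a\<in>ED. jump d (A + of_real e * d) a)"
        using jump_sum[OF d0 elim(2,3)] .
      finally show ?case using elim(4) by simp
    qed
    then show ?thesis by (simp add: eventually_const_iff)
  qed
  then show "norm d = 1 \<Longrightarrow> (\<Sum>t\<in>?TA. of_bool (d = sgn (q t - A)) - of_bool (d = sgn (r t - A)))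
      = of_bool (d = sgn (B - A)) - (of_bool (d = sgn (C - A)) :: real)" .
  \<comment> \<open>All directions that occur on either side, so that each value of \<open>g\<close>
    becomes a finite sum of multiples of indicators.\<close>
  define \<Lambda> where "\<Lambda> = (\<lambda>t. sgn (q t - A)) ` ?TA \<union> (\<lambda>t. sgn (r t - A)) ` ?TA \<union> {sgn (B - A), sgn (C - A)}"
  have fin\<Lambda>: "finite \<Lambda>" using fin by (simp add: \<Lambda>_def)
  have pick: "(\<Sum>d\<in>\<Lambda>. g d * (of_bool (d = x) - of_bool (d = y))) = g x - g y" if "x \<in> \<Lambda>" "y \<in> \<Lambda>" for x y
  proof -
    have "(\<Sum>d\<in>\<Lambda>. g d * (of_bool (d = x) - of_bool (d = y)))
        = (\<Sum>d\<in>\<Lambda>. if d = x then g d else 0) - (\<Sum>d\<in>\<Lambda>. if d = y then g d else 0)"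
      unfolding sum_subtractf[symmetric] by (intro sum.cong) auto
    then show ?thesis using that fin\<Lambda> by simp
  qed
  have unit: "norm d = 1" if "d \<in> \<Lambda>" for d
    using that t boundary_edges_distinct boundary_edges_distinct[OF D(2)] unfolding \<Lambda>_def
    by (fastforce simp: norm_sgn)
  have "(\<Sum>t\<in>?TA. g (sgn (q t - A)) - g (sgn (r t - A)))
      = (\<Sum>t\<in>?TA. \<Sum>d\<in>\<Lambda>. g d * (of_bool (d = sgn (q t - A)) - of_bool (d = sgn (r t - A))))"
    by (intro sum.cong refl pick[symmetric]) (auto simp: \<Lambda>_def)
  also have "\<dots> = (\<Sum>d\<in>\<Lambda>. g d * (\<Sum>t\<in>?TA. of_bool (d = sgn (q t - A)) - of_bool (d = sgn (r t - A))))"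
    unfolding sum_distrib_left by (rule sum.swap)
  also have "\<dots> = (\<Sum>d\<in>\<Lambda>. g d * (of_bool (d = sgn (B - A)) - of_bool (d = sgn (C - A))))"
    using * unit by (intro sum.cong) auto
  also have "\<dots> = g (sgn (B - A)) - g (sgn (C - A))" by (rule pick) (auto simp: \<Lambda>_def)
  finally show "(\<Sum>t\<in>?TA. g (sgn (q t - A)) - g (sgn (r t - A))) = g (sgn (B - A)) - g (sgn (C - A))" .
qed

section \<open>The colouring\<close>

text \<open>The parameters \<open>per\<close> and \<open>ar\<close> are the perimeter and twice the
  area of a tile. The condition \<open>tile_shape\<close> names one corner, but it holds for every
  cyclic labelling and so covers all three angles.\<close>

locale additive_tiling = dissection \<T> D E ED
  for \<T> D E ED +
  fixes A B C :: complex and \<rho> :: "real \<Rightarrow> real" and per ar :: real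
  assumes outer: "D = solid_triangle A B C" "side A B C > 0" "ED = {(A, B), (B, C), (C, A)}"
    and equilateral: "dist A B = dist B C" "dist B C = dist C A"
    and rho_add: "\<And>u v. \<rho> (u + v) = \<rho> u + \<rho> v"
    and rho_int: "\<And>k u. \<rho> (of_int k * u) = of_int k * \<rho> u"
    and rho_third: "\<rho> (pi / 3) = 1"
    and tile_shape: "\<And>t p q r. t \<in> \<T> \<Longrightarrow> E t = {(p, q), (q, r), (r, p)} \<Longrightarrow> side p q r > 0 \<Longrightarrow>
      \<rho> (angle q p r) = 1 \<and> side p q r = ar \<and> dist p q + dist q r + dist r p = per"
begin

text \<open>The value \<open>0\<close> at \<open>0\<close> makes this odd everywhere, as weights have to be.\<close>

definition arg_sign :: "complex \<Rightarrow> int" where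
  "arg_sign z = (if z = 0 then 0 else if even \<lfloor>\<rho> (Arg z)\<rfloor> then 1 else - 1)"

definition dir_sign :: "complex \<Rightarrow> int" where
  "dir_sign d = arg_sign (d / (B - A))"

section \<open>Signs of directions, of tiles and of the outer sides\<close>

lemma rho_0: "\<rho> 0 = 0"
  using rho_add[of 0 0] by simp

lemma rho_pi: "\<rho> pi = 3"
  using rho_int[of 3 "pi / 3"] rho_third by simp

text \<open>Arguments add up to a multiple of \<open>2 * pi\<close>, where \<rho> takes multiples of
  6. This even correction does not affect parity, so only \<open>k\<close> matters.\<close>

lemma arg_sign_cis:
  assumes "\<rho> \<theta> = of_int k"
  shows "arg_sign (z * cis \<theta>) = (if even k then 1 else - 1) * arg_sign z"
proof (cases "z = 0")
  case False
  then have "cis (Arg (z * cis \<theta>)) = cis (Arg z + \<theta>)"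
    by (simp add: cis_Arg sgn_mult cis_mult[symmetric])
  then obtain n :: int where n: "Arg (z * cis \<theta>) = Arg z + \<theta> + 2 * pi * n"
    using sin_cos_eq_iff[of "Arg (z * cis \<theta>)" "Arg z + \<theta>"] by (auto simp: complex_eq_iff)
  have "\<rho> (2 * pi * n) = of_int (6 * n)"
    using rho_int[of "2 * n" pi] rho_pi by (simp add: mult.commute mult.left_commute)
  then have "\<rho> (Arg (z * cis \<theta>)) = \<rho> (Arg z) + of_int (k + 6 * n)"
    by (simp add: n rho_add assms)
  then have "\<lfloor>\<rho> (Arg (z * cis \<theta>))\<rfloor> = \<lfloor>\<rho> (Arg z)\<rfloor> + (k + 6 * n)" by linarith
  then show ?thesis using False by (simp add: arg_sign_def)
qed (simp add: arg_sign_def)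

lemma dir_sign_cis:
  assumes "\<rho> \<theta> = of_int k"
  shows "dir_sign (d * cis \<theta>) = (if even k then 1 else - 1) * dir_sign d"
  using arg_sign_cis[OF assms, of "d / (B - A)"] by (simp add: dir_sign_def)

text \<open>A half turn has the odd value \<open>\<rho> pi = 3\<close>. This is the oddness required
  of a weight.\<close>

lemma dir_sign_minus: "dir_sign (- d) = - dir_sign d"
  using dir_sign_cis[of pi 3 d] rho_pi by simp

text \<open>Rotating \<open>r - q\<close> by the angle at \<open>q\<close> gives the direction of
  \<open>p - q\<close> and flips the sign, since \<rho> of the angle is 1; reversing to
  \<open>q - p\<close> flips it back.\<close>

lemma dir_sign_turn:
  assumes "side p q r > 0" "\<rho> (angle r q p) = 1"
  shows "dir_sign (sgn (r - q)) = dir_sign (sgn (q - p))"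
proof -
  have "side q r p > 0" using assms(1) by (simp add: side_cycle_pos)
  then have "sgn (p - q) = sgn (r - q) * cis (angle r q p)" by (rule sgn_cis_angle)
  then have "dir_sign (sgn (p - q)) = - dir_sign (sgn (r - q))"
    using dir_sign_cis[of "angle r q p" 1] assms(2) by simp
  moreover have "sgn (p - q) = - sgn (q - p)" using sgn_minus[of "q - p"] by simp
  ultimately show ?thesis using dir_sign_minus by simp
qed

lemma dir_sign_triangle:
  assumes "side p q r > 0" "\<rho> (angle r q p) = 1" "\<rho> (angle p r q) = 1"
    and "(u, v) \<in> {(p, q), (q, r), (r, p)}"
  shows "dir_sign (sgn (v - u)) = dir_sign (sgn (q - p))"
  using assms dir_sign_turn[of p q r] dir_sign_turn[of q r p] by (auto simp: side_cycle_pos)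

text \<open>Independent of the chosen edge: by \<open>dir_sign_edge\<close> all edges of a tile have
  the same sign.\<close>

definition tile_sign :: "complex set \<Rightarrow> int" where
  "tile_sign t = (let (p, q) = SOME e. e \<in> E t in dir_sign (sgn (q - p)))"

lemma tile_vertices:
  assumes "t \<in> \<T>" "(p, q) \<in> E t"
  obtains r where "side p q r > 0" "E t = {(p, q), (q, r), (r, p)}"
    "\<rho> (angle q p r) = 1" "\<rho> (angle r q p) = 1" "\<rho> (angle p r q) = 1"
    "side p q r = ar" "dist p q + dist q r + dist r p = per"
proof -
  obtain r where r: "side p q r > 0" "E t = {(p, q), (q, r), (r, p)}"
    using boundary_edges_rotate[OF tile_edges[OF assms(1)] assms(2)] by metis
  moreover have "E t = {(q, r), (r, p), (p, q)}" "E t = {(r, p), (p, q), (q, r)}" using r(2) by auto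
  moreover have "side q r p > 0" "side r p q > 0" using r(1) by (simp_all add: side_cycle_pos)
  ultimately show thesis
    using that tile_shape[OF assms(1)] by blast
qed

lemma dir_sign_edge:
  assumes "t \<in> \<T>" "(p, q) \<in> E t"
  shows "dir_sign (sgn (q - p)) = tile_sign t"
proof -
  obtain u v where uv: "(SOME e. e \<in> E t) = (u, v)" by (metis surj_pair)
  then have "(u, v) \<in> E t" using assms(2) by (metis someI)
  moreover obtain r where "side p q r > 0" "E t = {(p, q), (q, r), (r, p)}"
    "\<rho> (angle r q p) = 1" "\<rho> (angle p r q) = 1"
    using tile_vertices[OF assms] by metis
  ultimately show ?thesis using dir_sign_triangle[of p q r u v]
    unfolding tile_sign_def uv by simp
qed

lemma tile_sign_cases:
  assumes "t \<in> \<T>"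
  shows "tile_sign t = 1 \<or> tile_sign t = - 1"
proof -
  obtain p q where pq: "(p, q) \<in> E t" using tile_edges[OF assms] unfolding boundary_edges_def by blast
  have "q - p \<noteq> 0" using boundary_edges_distinct_ends[OF tile_edges[OF assms] pq] by simp
  moreover have "B - A \<noteq> 0" using boundary_edges_distinct[OF outer(2)] by simp
  ultimately have "sgn (q - p) / (B - A) \<noteq> 0" by (simp add: sgn_zero_iff)
  then show ?thesis unfolding dir_sign_edge[OF assms pq, symmetric] dir_sign_def arg_sign_def by simp
qed

lemma outer_angle: "angle B A C = pi / 3" "angle C B A = pi / 3" "angle A C B = pi / 3"
proof -
  have "arccos (1 / 2) = pi / 3" using arccos_cos[of "pi / 3"] by (simp add: cos_60)
  moreover have "dist A B \<noteq> 0" using boundary_edges_distinct[OF outer(2)] by simp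
  ultimately show "angle B A C = pi / 3" "angle C B A = pi / 3" "angle A C B = pi / 3"
    unfolding angle_dist using equilateral by (simp_all add: dist_commute power2_eq_square)
qed

text \<open>The side from \<open>A\<close> to \<open>B\<close> has argument 0 relative to itself,
  and \<open>\<rho> 0 = 0\<close> is even. The outer angles have \<rho>-value 1, like those of a
  tile, so the sign passes to the other sides.\<close>

lemma dir_sign_outer:
  assumes "(p, q) \<in> ED"
  shows "dir_sign (sgn (q - p)) = 1"
proof -
  have ne: "norm (B - A) > 0" using boundary_edges_distinct[OF outer(2)] by simp
  have "sgn (B - A) / (B - A) = of_real (inverse (norm (B - A)))"
    using ne by (simp add: sgn_div_norm scaleR_conv_of_real)
  then have "arg_sign (sgn (B - A) / (B - A)) = 1"
    using ne rho_0 by (simp add: arg_sign_def del: of_real_inverse)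
  then show ?thesis
    using dir_sign_triangle[OF outer(2), of p q] assms outer_angle rho_third
    unfolding outer(3) dir_sign_def by simp
qed

section \<open>The area identity and the perimeter identity\<close>

lemma area_identity: "real (card \<T>) * ar = side A B C"
proof -
  \<comment> \<open>With the height as weight, an edge contributes \<open>cross (v - u) u\<close>,
    which is \<open>- cross u v\<close>; the sum is the shoelace formula with reversed sign.\<close>
  have area: "(\<Sum>e\<in>{(p, q), (q, r), (r, p)}. weighted_length (\<lambda>d h. h) e) = - side p q r"
    if "side p q r > 0" for p q r
  proof -
    have "weighted_length (\<lambda>d h. h) (u, v) = cross (v - u) u" for u v
      by (cases "u = v") (simp_all add: weighted_length_def sgn_div_norm cross_def field_simps)
    then show ?thesis unfolding boundary_edges_sum[OF that]
      by (simp add: side_def cross_def) (simp add: algebra_simps)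
  qed
  have "(\<Sum>e\<in>E t. weighted_length (\<lambda>d h. h) e) = - ar" if t: "t \<in> \<T>" for t
  proof -
    obtain p q where "(p, q) \<in> E t" using tile_edges[OF t] unfolding boundary_edges_def by blast
    then obtain r where "side p q r > 0" "E t = {(p, q), (q, r), (r, p)}" "side p q r = ar"
      using tile_vertices[OF t] by metis
    then show ?thesis using area by simp
  qed
  then have "(\<Sum>t\<in>\<T>. \<Sum>e\<in>E t. weighted_length (\<lambda>d h. h) e) = - (real (card \<T>) * ar)" by simp
  moreover have "(\<Sum>e\<in>ED. weighted_length (\<lambda>d h. h) e) = - side A B C"
    unfolding outer(3) by (rule area[OF outer(2)])
  ultimately show ?thesis using weighted_length_sum[of "\<lambda>d h. h"] by simp
qed

lemma perimeter_identity: "of_int (\<Sum>t\<in>\<T>. tile_sign t) * per = 3 * dist A B"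
proof -
  let ?w = "\<lambda>d (h :: real). real_of_int (dir_sign d)"
  have perim: "(\<Sum>e\<in>{(p, q), (q, r), (r, p)}. weighted_length ?w e) = of_int s * (dist p q + dist q r + dist r p)"
    if "side p q r > 0" "\<And>u v. (u, v) \<in> {(p, q), (q, r), (r, p)} \<Longrightarrow> dir_sign (sgn (v - u)) = s" for p q r s
    unfolding boundary_edges_sum[OF that(1)] using that(2)
    by (simp add: weighted_length_def dist_norm norm_minus_commute algebra_simps)
  have "(\<Sum>e\<in>E t. weighted_length ?w e) = of_int (tile_sign t) * per" if t: "t \<in> \<T>" for t
  proof -
    obtain p q where "(p, q) \<in> E t" using tile_edges[OF t] unfolding boundary_edges_def by blast
    then obtain r where r: "side p q r > 0" "E t = {(p, q), (q, r), (r, p)}"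
      "dist p q + dist q r + dist r p = per"
      using tile_vertices[OF t] by metis
    have "dir_sign (sgn (v - u)) = tile_sign t" if "(u, v) \<in> {(p, q), (q, r), (r, p)}" for u v
      using dir_sign_edge[OF t, of u v] that r(2) by simp
    then show ?thesis using perim[OF r(1), of "tile_sign t"] r(2,3) by simp
  qed
  then have "(\<Sum>t\<in>\<T>. \<Sum>e\<in>E t. weighted_length ?w e) = of_int (\<Sum>t\<in>\<T>. tile_sign t) * per"
    by (simp add: sum_distrib_right)
  moreover have "(\<Sum>e\<in>ED. weighted_length ?w e) = of_int 1 * (dist A B + dist B C + dist C A)"
    unfolding outer(3) by (rule perim[OF outer(2)]) (use dir_sign_outer outer(3) in blast)
  ultimately show ?thesis
    using weighted_length_sum[of ?w] dir_sign_minus equilateral by simp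
qed

text \<open>Both numbers lie in the closed upper half plane, so both arguments lie between 0 and
  \<open>pi\<close> and no reduction modulo \<open>2 * pi\<close> can occur.\<close>

lemma Arg_mult_cis_upper:
  assumes "z \<noteq> 0" "Im z \<ge> 0" "Im (z * cis \<theta>) \<ge> 0" "0 < \<theta>" "\<theta> < pi"
  shows "Arg (z * cis \<theta>) = Arg z + \<theta>"
proof -
  have "cis (Arg (z * cis \<theta>)) = cis (Arg z + \<theta>)"
    using assms(1) by (simp add: cis_Arg sgn_mult cis_mult[symmetric])
  then obtain n :: int where n: "Arg (z * cis \<theta>) = Arg z + \<theta> + 2 * pi * n"
    using sin_cos_eq_iff[of "Arg (z * cis \<theta>)" "Arg z + \<theta>"] by (auto simp: complex_eq_iff)
  have "0 \<le> Arg z" "0 \<le> Arg (z * cis \<theta>)" using assms Arg_less_0 by auto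
  moreover have "Arg z \<le> pi" "Arg (z * cis \<theta>) \<le> pi" by (simp_all add: Arg_le_pi)
  ultimately have "\<bar>2 * pi * n\<bar> < 2 * pi" using n assms by linarith
  then have "\<bar>real_of_int n\<bar> < 1" by (simp add: abs_mult)
  then have "n = 0" by linarith
  then show ?thesis using n by simp
qed

text \<open>The triangle \<open>D\<close> lies to the left of \<open>AB\<close>, so directions from
  \<open>A\<close> to its points, divided by \<open>B - A\<close>, lie in the closed upper half
  plane, where arguments add without wrapping.\<close>

lemma corner_arg_step:
  assumes pos: "side A q r > 0" and mem: "q \<in> D" "r \<in> D"
  shows "\<rho> (Arg (sgn (r - A) / (B - A))) = \<rho> (Arg (sgn (q - A) / (B - A))) + \<rho> (angle q A r)"
proof -
  have im: "Im (sgn (v - A) / (B - A)) \<ge> 0" if "v \<in> D" for v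
  proof -
    have "side A B v \<ge> 0" using that mem_solid_triangle_iff[OF outer(2)] outer(1) by simp
    moreover have "Im (sgn (v - A) / (B - A)) = side A B v / (norm (v - A) * (norm (B - A))\<^sup>2)"
    proof -
      have "Im (sgn u / w) = cross w u / (norm u * (norm w)\<^sup>2)" for u w
      proof -
        have "Im (sgn u / w) = (Im u / norm u * Re w - Re u / norm u * Im w) / (norm w)\<^sup>2"
          by (simp add: Im_divide cmod_power2)
        also have "\<dots> = cross w u / (norm u * (norm w)\<^sup>2)"
          by (cases "u = 0") (simp_all add: cross_def field_simps)
        finally show ?thesis .
      qed
      then show ?thesis by (simp add: side_def)
    qed
    ultimately show ?thesis by simp
  qed
  have ne: "sgn (q - A) / (B - A) \<noteq> 0"
    using boundary_edges_distinct[OF pos] boundary_edges_distinct[OF outer(2)] by (simp add: sgn_zero_iff)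
  have eq: "sgn (r - A) / (B - A) = sgn (q - A) / (B - A) * cis (angle q A r)"
    using sgn_cis_angle[OF pos] by simp
  have "Arg (sgn (q - A) / (B - A) * cis (angle q A r)) = Arg (sgn (q - A) / (B - A)) + angle q A r"
    using im[OF mem(1)] im[OF mem(2)] cos_sin_angle(3,4)[OF pos] ne
    by (intro Arg_mult_cis_upper) (simp_all only: eq[symmetric] not_False_eq_True)
  then show ?thesis unfolding eq by (simp add: rho_add)
qed

lemma corner_tile:
  obtains t where "{t. t \<in> \<T> \<and> A \<in> t} = {t}" "tile_sign t = 1"
proof -
  have "\<exists>q r. side A q r > 0 \<and> E t = {(A, q), (q, r), (r, A)} \<and> t = solid_triangle A q r"
    if t: "t \<in> \<T>" "A \<in> t" for t
  proof -
    have "t \<subseteq> solid_triangle A B C" using t(1) tiles_Union outer(1) by auto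
    then show ?thesis
      using vertex_of_subtriangle[OF outer(2) tile_edges[OF t(1)] _ t(2)] by metis
  qed
  then obtain q r where qr: "\<And>t. t \<in> \<T> \<Longrightarrow> A \<in> t \<Longrightarrow>
      side A (q t) (r t) > 0 \<and> E t = {(A, q t), (q t, r t), (r t, A)} \<and> t = solid_triangle A (q t) (r t)"
    by metis
  have qr': "side A (q t) (r t) > 0 \<and> E t = {(A, q t), (q t, r t), (r t, A)}" if "t \<in> \<T>" "A \<in> t" for t
    using qr that by blast
  let ?TA = "{t. t \<in> \<T> \<and> A \<in> t}"
  \<comment> \<open>each tile at \<open>A\<close> contributes \<open>1\<close> to the increase of \<open>g\<close> from \<open>AB\<close> to \<open>AC\<close>, which is
    \<open>\<rho> (\<pi>/3) = 1\<close>\<close>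
  define g where "g d = \<rho> (Arg (d / (B - A)))" for d
  have step: "g (sgn (q t - A)) - g (sgn (r t - A)) = - 1" if t: "t \<in> ?TA" for t
  proof -
    have "t = solid_triangle A (q t) (r t)" using qr[of t] t by blast
    moreover have "q t \<in> solid_triangle A (q t) (r t)" "r t \<in> solid_triangle A (q t) (r t)"
      by (simp_all add: solid_triangle_def hull_inc)
    ultimately have "q t \<in> t" "r t \<in> t" by metis+
    then have "q t \<in> D" "r t \<in> D" using t tiles_Union by auto
    moreover have "side A (q t) (r t) > 0" "\<rho> (angle (q t) A (r t)) = 1"
      using qr'[of t] tile_shape[of t A "q t" "r t"] t by blast+
    ultimately show ?thesis using corner_arg_step[of "q t" "r t"] by (simp add: g_def)
  qed
  have "B \<in> D" "C \<in> D" by (simp_all add: outer(1) solid_triangle_def hull_inc)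
  then have "g (sgn (B - A)) - g (sgn (C - A)) = - 1"
    using corner_arg_step[OF outer(2)] outer_angle(1) rho_third by (simp add: g_def)
  then have "(\<Sum>t\<in>?TA. g (sgn (q t - A)) - g (sgn (r t - A))) = - 1"
    using vertex_edge_directions(2)[OF outer qr', of g] by simp
  then have "card ?TA = 1" using step by simp
  then obtain t where t: "?TA = {t}" using card_1_singletonE by blast
  have nC: "sgn (B - A) \<noteq> sgn (C - A)"
    using \<open>g (sgn (B - A)) - g (sgn (C - A)) = - 1\<close> by auto
  have unit: "norm (sgn (B - A)) = 1" using boundary_edges_distinct[OF outer(2)] by (simp add: norm_sgn)
  \<comment> \<open>A difference of two truth values equals 1 only if the first holds: the corner
    tile has its first edge along \<open>AB\<close> and inherits the sign of that side.\<close>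
  have "of_bool (sgn (B - A) = sgn (q t - A)) - of_bool (sgn (B - A) = sgn (r t - A)) = (1 :: real)"
    using vertex_edge_directions(1)[OF outer qr' unit] nC unfolding t by simp
  then have "sgn (B - A) = sgn (q t - A)" by (auto simp: of_bool_def split: if_splits)
  moreover have "(A, q t) \<in> E t" "t \<in> \<T>" using qr' t by blast+
  moreover have "dir_sign (sgn (B - A)) = 1" using dir_sign_outer outer(3) by blast
  ultimately have "tile_sign t = 1" using dir_sign_edge[of t A "q t"] by simp
  then show thesis using that t by blast
qed

text \<open>The tiles of sign 1 form a colouring, because edges along a shared segment are opposite.
  Any colouring agrees with it at the corner tile and hence everywhere, so the definite description
  has this unique value.\<close>

lemma coloring_number_eq: "coloring_number \<T> A = (\<Sum>t\<in>\<T>. tile_sign t)"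
proof -
  define Bl where "Bl = {t \<in> \<T>. tile_sign t = 1}"
  obtain t0 where t0: "{t. t \<in> \<T> \<and> A \<in> t} = {t0}" "tile_sign t0 = 1" using corner_tile .
  have t0': "t0 \<in> \<T>" "A \<in> t0" using equalityD2[OF t0(1)] by simp_all
  have opp: "tile_sign t = - tile_sign s" if st: "s \<in> \<T>" "t \<in> \<T>" "s \<noteq> t" "share_segment s t" for s t
  proof -
    obtain p q p' q' where "(p, q) \<in> E s" "(p', q') \<in> E t" "sgn (q' - p') = - sgn (q - p)"
      using shared_segment_opposite_edges[OF st] .
    then show ?thesis using dir_sign_edge st dir_sign_minus by metis
  qed
  have col: "is_coloring \<T> A Bl"
    unfolding is_coloring_def
  proof (intro conjI ballI impI)
    fix s t assume "s \<in> \<T>" "t \<in> \<T>" "s \<noteq> t \<and> share_segment s t"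
    then show "(s \<in> Bl) = (t \<notin> Bl)"
      using opp[of s t] tile_sign_cases[of s] by (auto simp: Bl_def)
  next
    fix t assume "t \<in> \<T>" "A \<in> t"
    then have "t \<in> {t. t \<in> \<T> \<and> A \<in> t}" by blast
    then have "t = t0" unfolding t0(1) by simp
    then show "t \<in> Bl" using t0(2) \<open>t \<in> \<T>\<close> by (simp add: Bl_def)
  qed (auto simp: Bl_def)
  have uniq: "P = Bl" if P: "is_coloring \<T> A P" for P
  proof -
    define S where "S = {t \<in> \<T>. t \<in> P \<longleftrightarrow> t \<in> Bl}"
    have "S = \<T>"
    proof (rule adjacency_connected)
      have "t0 \<in> P" "t0 \<in> Bl" using t0' P col by (simp_all add: is_coloring_def)
      then show "S \<noteq> {}" using t0'(1) unfolding S_def by blast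
      fix s t assume "s \<in> S" "t \<in> \<T>" "s \<noteq> t" "share_segment s t"
      moreover from this have "s \<in> \<T>" by (simp add: S_def)
      ultimately have "s \<in> P \<longleftrightarrow> t \<notin> P" "s \<in> Bl \<longleftrightarrow> t \<notin> Bl"
        using P col by (simp_all add: is_coloring_def)
      then show "t \<in> S" using \<open>s \<in> S\<close> \<open>t \<in> \<T>\<close> by (simp add: S_def)
    qed (auto simp: S_def)
    moreover have "P \<subseteq> \<T>" "Bl \<subseteq> \<T>" using P col by (auto simp: is_coloring_def)
    ultimately show ?thesis unfolding S_def by blast
  qed
  have "(\<Sum>t\<in>\<T>. tile_sign t) = (\<Sum>t\<in>Bl. tile_sign t) + (\<Sum>t\<in>\<T> - Bl. tile_sign t)"
    using finite_tiles by (subst sum.subset_diff[of Bl]) (auto simp: Bl_def)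
  also have "(\<Sum>t\<in>Bl. tile_sign t) = int (card Bl)" by (simp add: Bl_def)
  also have "(\<Sum>t\<in>\<T> - Bl. tile_sign t) = (\<Sum>t\<in>\<T> - Bl. - 1)"
    using tile_sign_cases by (intro sum.cong) (auto simp: Bl_def)
  finally have sum: "(\<Sum>t\<in>\<T>. tile_sign t) = int (card Bl) - int (card (\<T> - Bl))" by simp
  show ?thesis unfolding coloring_number_def sum
    by (rule the_equality) (use col uniq in blast)+
qed

end

section \<open>The shape of the tile\<close>

text \<open>Squaring the perimeter identity and inserting the area gives
  \<open>m\<^sup>2 * (a + b + c)\<^sup>2 = 9 * n * (a * b)\<close>. Since
  \<open>3 * (a * b) = (a + b)\<^sup>2 - c\<^sup>2\<close>, a factor \<open>a + b + c\<close>
  cancels and a linear relation between \<open>a + b\<close> and \<open>c\<close> remains.\<close>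

lemma ratios_from_invariants:
  fixes a b c n m X :: real
  assumes pos: "a > 0" "b > 0" "c > 0" "X > 0" and ne: "a \<noteq> b"
    and cosines: "c\<^sup>2 = a\<^sup>2 + b\<^sup>2 - a * b"
    and area: "X\<^sup>2 = n * (a * b)"
    and perimeter: "m * (a + b + c) = 3 * X"
  shows "m\<^sup>2 < n" "(3 * n - m\<^sup>2) * (a + b) = (3 * n + m\<^sup>2) * c"
    "{a / c, b / c} =
      {1 / 2 * ((3 * n + m\<^sup>2) / (3 * n - m\<^sup>2) + sqrt ((9 * n - m\<^sup>2) * (n - m\<^sup>2)) / (3 * n - m\<^sup>2)),
       1 / 2 * ((3 * n + m\<^sup>2) / (3 * n - m\<^sup>2) - sqrt ((9 * n - m\<^sup>2) * (n - m\<^sup>2)) / (3 * n - m\<^sup>2))}"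
proof -
  define k where "k = 3 * n - m\<^sup>2"
  define l where "l = 3 * n + m\<^sup>2"
  have "m\<^sup>2 * (a + b + c)\<^sup>2 = (3 * X)\<^sup>2" using perimeter by (metis power_mult_distrib)
  also have "\<dots> = 3 * n * (3 * (a * b))" using area by (simp add: power_mult_distrib)
  also have "3 * (a * b) = (a + b - c) * (a + b + c)" using cosines by algebra
  finally have "(m\<^sup>2 * (a + b + c)) * (a + b + c) = (3 * n * (a + b - c)) * (a + b + c)"
    by (simp only: power2_eq_square mult.assoc)
  then have "m\<^sup>2 * (a + b + c) = 3 * n * (a + b - c)" using pos by simp
  then have lin: "k * (a + b) = l * c" by (simp add: k_def l_def algebra_simps)
  then show "(3 * n - m\<^sup>2) * (a + b) = (3 * n + m\<^sup>2) * c" by (simp add: k_def l_def)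
  have "n * (a * b) > 0" using area pos by (metis zero_less_power)
  then have n: "n > 0" by (rule zero_less_mult_pos2) (use pos in simp)
  then have l: "l > 0" by (simp add: l_def add_pos_nonneg)
  then have "k * (a + b) > 0" using lin pos by simp
  then have k: "k > 0" using pos by (simp add: zero_less_mult_iff)
  \<comment> \<open>For \<open>a \<noteq> b\<close> this yields \<open>a + b < 2 * c\<close>, hence
    \<open>l < 2 * k\<close>, which is the bound on \<open>m\<^sup>2\<close>.\<close>
  have diff: "3 * (a - b)\<^sup>2 = (2 * c - (a + b)) * (2 * c + (a + b))" using cosines by algebra
  have "3 * (a - b)\<^sup>2 > 0" using ne by simp
  then have "2 * c - (a + b) > 0" unfolding diff using pos by (simp add: zero_less_mult_iff)
  then have "k * (a + b) < k * (2 * c)" using k by simp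
  then have "l * c < (2 * k) * c" unfolding lin by (simp add: mult_ac)
  then have "l < 2 * k" using pos by simp
  then show "m\<^sup>2 < n" by (simp add: k_def l_def)
  define w where "w = sqrt ((9 * n - m\<^sup>2) * (n - m\<^sup>2))"
  \<comment> \<open>Here \<open>2 * k - l = 3 * (n - m\<^sup>2)\<close> and
    \<open>2 * k + l = 9 * n - m\<^sup>2\<close>. So the root is
    \<open>k * \<bar>a - b\<bar> / c\<close>, and the two ratios are recovered from their sum and
    difference.\<close>
  have disc: "(9 * n - m\<^sup>2) * (n - m\<^sup>2) = (k * (a - b) / c)\<^sup>2"
  proof -
    have "3 * ((9 * n - m\<^sup>2) * (n - m\<^sup>2) * c\<^sup>2) = (2 * k - l) * (2 * k + l) * c\<^sup>2"
      by (simp add: k_def l_def power2_eq_square algebra_simps)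
    also have "\<dots> = (2 * k * c - l * c) * (2 * k * c + l * c)"
      by (simp add: power2_eq_square algebra_simps)
    also have "\<dots> = k\<^sup>2 * ((2 * c - (a + b)) * (2 * c + (a + b)))"
      unfolding lin[symmetric] by (simp add: power2_eq_square algebra_simps)
    also have "\<dots> = 3 * (k * (a - b))\<^sup>2" unfolding diff[symmetric] by (simp add: power_mult_distrib)
    finally have "(9 * n - m\<^sup>2) * (n - m\<^sup>2) * c\<^sup>2 = (k * (a - b))\<^sup>2" by simp
    then show ?thesis using pos by (simp add: power_divide field_simps)
  qed
  then have w: "w / k = \<bar>a - b\<bar> / c" using k pos by (simp add: w_def abs_mult)
  have u: "l / k = (a + b) / c" using lin k pos by (simp add: field_simps)
  show "{a / c, b / c} =
      {1 / 2 * ((3 * n + m\<^sup>2) / (3 * n - m\<^sup>2) + sqrt ((9 * n - m\<^sup>2) * (n - m\<^sup>2)) / (3 * n - m\<^sup>2)),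
       1 / 2 * ((3 * n + m\<^sup>2) / (3 * n - m\<^sup>2) - sqrt ((9 * n - m\<^sup>2) * (n - m\<^sup>2)) / (3 * n - m\<^sup>2))}"
    unfolding k_def[symmetric] l_def[symmetric] w_def[symmetric] u w
  proof (cases "a > b")
    case True
    then have "1 / 2 * ((a + b) / c + \<bar>a - b\<bar> / c) = a / c" "1 / 2 * ((a + b) / c - \<bar>a - b\<bar> / c) = b / c"
      using pos by (simp_all add: field_simps)
    then show "{a / c, b / c} = {1 / 2 * ((a + b) / c + \<bar>a - b\<bar> / c), 1 / 2 * ((a + b) / c - \<bar>a - b\<bar> / c)}"
      by simp
  next
    case False
    then have "1 / 2 * ((a + b) / c + \<bar>a - b\<bar> / c) = b / c" "1 / 2 * ((a + b) / c - \<bar>a - b\<bar> / c) = a / c"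
      using pos by (simp_all add: field_simps)
    then show "{a / c, b / c} = {1 / 2 * ((a + b) / c + \<bar>a - b\<bar> / c), 1 / 2 * ((a + b) / c - \<bar>a - b\<bar> / c)}"
      by auto
  qed
qed

section \<open>The quadratic equation for \<open>cis \<alpha>\<close>\<close>

definition \<omega> :: complex where
  "\<omega> = cis (pi / 3)"

text \<open>With \<zeta> for \<open>cis \<alpha>\<close>, the ratio \<open>(a + b) / c\<close> is
  \<open>2 * cos (\<alpha> - pi / 3)\<close>, that is
  \<open>cnj \<omega> * \<zeta> + \<omega> / \<zeta>\<close>; multiplying by
  \<open>k * \<zeta>\<close> clears the denominators.\<close>

lemma cis_quadratic:
  fixes \<alpha> a b c k l :: real
  assumes pos: "a > 0" "b > 0" "c > 0"
    and cosines: "c\<^sup>2 = a\<^sup>2 + b\<^sup>2 - a * b"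
    and cos: "cos \<alpha> = (b\<^sup>2 + c\<^sup>2 - a\<^sup>2) / (2 * (b * c))" and sin: "sin \<alpha> = sqrt 3 * a / (2 * c)"
    and lin: "k * (a + b) = l * c"
  shows "of_real k * cnj \<omega> * (cis \<alpha>)\<^sup>2 + - of_real l * cis \<alpha> + of_real k * \<omega> = 0"
proof -
  have c1: "cos \<alpha> = (2 * b - a) / (2 * c)"
    unfolding cos cosines using pos by (simp add: power2_eq_square field_simps)
  have "cos \<alpha> + sqrt 3 * sin \<alpha> = ((2 * b - a) + 3 * a) / (2 * c)"
    unfolding c1 sin add_divide_distrib by simp
  also have "\<dots> = (a + b) / c" using pos by (simp add: field_simps)
  finally have c2: "k * (cos \<alpha> + sqrt 3 * sin \<alpha>) = l" using lin pos by simp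
  have "cnj \<omega> * cis \<alpha> + cis (- \<alpha>) * \<omega> = of_real (cos \<alpha> + sqrt 3 * sin \<alpha>)"
    by (simp add: \<omega>_def complex_eq_iff cos_60 sin_60)
  then have "of_real k * (cnj \<omega> * cis \<alpha> + cis (- \<alpha>) * \<omega>) = of_real l"
    by (metis c2 of_real_mult)
  then have "of_real k * (cnj \<omega> * cis \<alpha> + cis (- \<alpha>) * \<omega>) * cis \<alpha> = of_real l * cis \<alpha>" by simp
  moreover have "of_real k * (cnj \<omega> * cis \<alpha> + cis (- \<alpha>) * \<omega>) * cis \<alpha>
      = of_real k * cnj \<omega> * (cis \<alpha>)\<^sup>2 + of_real k * (cis (- \<alpha>) * cis \<alpha>) * \<omega>"
    unfolding power2_eq_square by (simp only: distrib_left distrib_right mult.assoc mult.commute mult.left_commute)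
  moreover have "cis (- \<alpha>) * cis \<alpha> = 1" by (simp add: cis_mult)
  ultimately have eq: "of_real k * cnj \<omega> * (cis \<alpha>)\<^sup>2 + of_real k * \<omega> = of_real l * cis \<alpha>"
    by (metis mult.right_neutral)
  have "of_real k * cnj \<omega> * (cis \<alpha>)\<^sup>2 + - of_real l * cis \<alpha> + of_real k * \<omega>
      = (of_real k * cnj \<omega> * (cis \<alpha>)\<^sup>2 + of_real k * \<omega>) - of_real l * cis \<alpha>" by simp
  then show ?thesis unfolding eq by simp
qed

section \<open>The field generated by \<open>\<i> * sqrt 3\<close> and the coefficient
  polynomials\<close>

lemma Q_isqrt3_subfield: "is_subfield Q_isqrt3"
  unfolding Q_isqrt3_def is_subfield_def by blast

lemma Q_isqrt3_closed:
  shows "0 \<in> Q_isqrt3" "1 \<in> Q_isqrt3" "\<i> * of_real (sqrt 3) \<in> Q_isqrt3"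
    "x \<in> Q_isqrt3 \<Longrightarrow> y \<in> Q_isqrt3 \<Longrightarrow> x - y \<in> Q_isqrt3"
    "x \<in> Q_isqrt3 \<Longrightarrow> y \<in> Q_isqrt3 \<Longrightarrow> x * y \<in> Q_isqrt3"
    "x \<in> Q_isqrt3 \<Longrightarrow> inverse x \<in> Q_isqrt3"
proof -
  note K = Q_isqrt3_subfield[unfolded is_subfield_def]
  show "0 \<in> Q_isqrt3" "1 \<in> Q_isqrt3" using K by simp_all
  show "\<i> * of_real (sqrt 3) \<in> Q_isqrt3" by (simp add: Q_isqrt3_def)
  show "x \<in> Q_isqrt3 \<Longrightarrow> y \<in> Q_isqrt3 \<Longrightarrow> x - y \<in> Q_isqrt3"
    "x \<in> Q_isqrt3 \<Longrightarrow> y \<in> Q_isqrt3 \<Longrightarrow> x * y \<in> Q_isqrt3"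
    "x \<in> Q_isqrt3 \<Longrightarrow> inverse x \<in> Q_isqrt3"
    using K by simp_all
qed

lemma Q_isqrt3_minus: "x \<in> Q_isqrt3 \<Longrightarrow> - x \<in> Q_isqrt3"
  using Q_isqrt3_closed(4)[OF Q_isqrt3_closed(1), of x] by simp

lemma Q_isqrt3_add: "x \<in> Q_isqrt3 \<Longrightarrow> y \<in> Q_isqrt3 \<Longrightarrow> x + y \<in> Q_isqrt3"
  using Q_isqrt3_closed(4)[of x "- y"] Q_isqrt3_minus[of y] by simp

lemma Q_isqrt3_of_nat: "of_nat n \<in> Q_isqrt3"
  by (induction n) (auto intro: Q_isqrt3_closed Q_isqrt3_add)

lemma Q_isqrt3_omega: "\<omega> \<in> Q_isqrt3" "cnj \<omega> \<in> Q_isqrt3"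
proof -
  have h: "inverse 2 \<in> Q_isqrt3" using Q_isqrt3_closed(6)[OF Q_isqrt3_of_nat[of 2]] by simp
  have "\<omega> = inverse 2 * (1 + \<i> * of_real (sqrt 3))" "cnj \<omega> = inverse 2 * (1 - \<i> * of_real (sqrt 3))"
    by (simp_all add: \<omega>_def complex_eq_iff cos_60 sin_60)
  then show "\<omega> \<in> Q_isqrt3" "cnj \<omega> \<in> Q_isqrt3"
    using h by (metis Q_isqrt3_add Q_isqrt3_closed(2-5))+
qed

text \<open>Encodes \<open>c\<^sub>1 N + c\<^sub>2 M\<^sup>2\<close>, with \<open>N\<close> the outer and \<open>M\<close> the inner variable.\<close>

definition linear_quadratic :: "complex \<Rightarrow> complex \<Rightarrow> complex poly poly" where
  "linear_quadratic c1 c2 = [:[:0, 0, c2:], [:c1:]:]"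

lemma eval2_linear_quadratic: "eval2 (linear_quadratic c1 c2) x y = c1 * x + c2 * y\<^sup>2"
  by (simp add: eval2_def linear_quadratic_def power2_eq_square algebra_simps)

lemma poly2_over_linear_quadratic:
  assumes "c1 \<in> Q_isqrt3" "c2 \<in> Q_isqrt3"
  shows "poly2_over Q_isqrt3 (linear_quadratic c1 c2)"
  using assms Q_isqrt3_closed(1)
  by (auto simp: poly2_over_def linear_quadratic_def coeff_pCons split: nat.split)

text \<open>All of this is the law of cosines with \<open>cos (pi / 3) = 1 / 2\<close>, together
  with the area formula and the angle sum.\<close>

lemma tile_data:
  fixes U V W :: complex
  assumes tri: "is_triangle U V W" and \<gamma>: "angle U W V = pi / 3"
    and a: "a = dist V W" and b: "b = dist U W" and c: "c = dist U V"
  shows "a > 0" "b > 0" "c > 0" "c\<^sup>2 = a\<^sup>2 + b\<^sup>2 - a * b"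
    "\<bar>side U V W\<bar> = sqrt 3 / 2 * (a * b)"
    "cos (angle V U W) = (b\<^sup>2 + c\<^sup>2 - a\<^sup>2) / (2 * (b * c))"
    "sin (angle V U W) = sqrt 3 * a / (2 * c)"
    "angle V U W + angle U V W = 2 * pi / 3"
    "a = b \<Longrightarrow> angle U V W = pi / 3"
proof -
  have s0: "side U V W \<noteq> 0" by (rule is_triangle_side[OF tri])
  have sW: "side U W V = - side U V W" by (rule side_commute)
  have ne: "U \<noteq> V" "V \<noteq> W" "U \<noteq> W" using s0 by (auto simp: side_def cross_def)
  then show pos: "a > 0" "b > 0" "c > 0" by (simp_all add: a b c)
  have cosW: "cos (angle U W V) = (a\<^sup>2 + b\<^sup>2 - c\<^sup>2) / (2 * (a * b))"
    and cosU: "cos (angle V U W) = (b\<^sup>2 + c\<^sup>2 - a\<^sup>2) / (2 * (b * c))"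
    and sinU: "sin (angle V U W) = \<bar>side U V W\<bar> / (b * c)"
    and sum: "angle V U W + angle U V W + angle U W V = pi"
  proof -
    have "cos (angle U W V) = ((U - W) \<bullet> (V - W)) / (norm (U - W) * norm (V - W)) \<and>
      cos (angle V U W) = ((V - U) \<bullet> (W - U)) / (norm (V - U) * norm (W - U)) \<and>
      sin (angle V U W) = \<bar>side U V W\<bar> / (norm (V - U) * norm (W - U)) \<and>
      angle V U W + angle U V W + angle U W V = pi"
    \<comment> \<open>The angle lemmas require counterclockwise order; in the other case
      \<open>V\<close> and \<open>W\<close> are exchanged, which changes only the sign of the
      area.\<close>
    proof (cases "side U V W > 0")
      case True
      then have "side W U V > 0" by (simp add: side_cycle_pos)
      then show ?thesis
        using cos_sin_angle(1)[of W U V] cos_sin_angle(1,2)[OF True] angle_sum_triangle[OF True] True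
        by (simp add: angle_commute[of W V U])
    next
      case False
      then have pos: "side U W V > 0" using s0 sW by simp
      then have "side W V U > 0" by (simp add: side_cycle_pos)
      then show ?thesis
        using cos_sin_angle(1)[of W V U] cos_sin_angle(1,2)[OF pos] angle_sum_triangle[OF pos] pos sW
        by (simp add: angle_commute[of V W U] angle_commute[of W U V] inner_commute mult.commute)
    qed
    then show "cos (angle U W V) = (a\<^sup>2 + b\<^sup>2 - c\<^sup>2) / (2 * (a * b))"
      "cos (angle V U W) = (b\<^sup>2 + c\<^sup>2 - a\<^sup>2) / (2 * (b * c))"
      "sin (angle V U W) = \<bar>side U V W\<bar> / (b * c)"
      "angle V U W + angle U V W + angle U W V = pi"
      unfolding a b c dist_norm dot_norm_neg
      by (simp_all add: norm_minus_commute[of U V] norm_minus_commute[of W U] norm_minus_commute[of W V]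
          add.commute mult.commute)
  qed
  have "(a\<^sup>2 + b\<^sup>2 - c\<^sup>2) / (2 * (a * b)) = 1 / 2" using cosW[unfolded \<gamma> cos_60, symmetric] .
  then have "a\<^sup>2 + b\<^sup>2 - c\<^sup>2 = 1 / 2 * (2 * (a * b))" using pos by (subst (asm) nonzero_divide_eq_eq) auto
  then show cosines: "c\<^sup>2 = a\<^sup>2 + b\<^sup>2 - a * b" by simp
  have "(side W U V)\<^sup>2 = b\<^sup>2 * a\<^sup>2 - ((b\<^sup>2 + a\<^sup>2 - c\<^sup>2) / 2)\<^sup>2"
    unfolding side_squared_dist a b c by (simp add: dist_commute)
  also have "\<dots> = 3 / 4 * (a * b)\<^sup>2" unfolding cosines by (simp add: power2_eq_square algebra_simps)
  also have "\<dots> = (sqrt 3 / 2 * (a * b))\<^sup>2" by (simp add: power_mult_distrib power_divide)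
  finally have "\<bar>side W U V\<bar> = \<bar>sqrt 3 / 2 * (a * b)\<bar>" by (metis power2_eq_iff abs_minus_cancel)
  then show area: "\<bar>side U V W\<bar> = sqrt 3 / 2 * (a * b)"
    using pos side_cycle(2)[of W U V] by (simp add: abs_mult)
  show "cos (angle V U W) = (b\<^sup>2 + c\<^sup>2 - a\<^sup>2) / (2 * (b * c))" by (rule cosU)
  show "sin (angle V U W) = sqrt 3 * a / (2 * c)" unfolding sinU area using pos by simp
  show "angle V U W + angle U V W = 2 * pi / 3" using sum \<gamma> by simp
  \<comment> \<open>Two equal sides enclosing \<open>pi / 3\<close> make the tile
    equilateral.\<close>
  show "angle U V W = pi / 3" if "a = b"
  proof -
    have "c\<^sup>2 = a\<^sup>2" using cosines that by (simp add: power2_eq_square)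
    then have "c = a" using pos by (simp add: power2_eq_iff_nonneg)
    then have "angle U V W = arccos (1 / 2)"
      using that pos unfolding angle_dist a b c by (simp add: dist_commute power2_eq_square)
    also have "\<dots> = pi / 3" using arccos_cos[of "pi / 3"] by (simp add: cos_60)
    finally show ?thesis .
  qed
qed

lemma equilateral_side:
  assumes "dist A B = dist B C" "dist B C = dist C A" "side A B C > 0"
  shows "side A B C = sqrt 3 / 2 * (dist A B)\<^sup>2"
proof -
  have "(side A B C)\<^sup>2 = (sqrt 3 / 2 * (dist A B)\<^sup>2)\<^sup>2"
    unfolding side_squared_dist using assms by (simp add: power_mult_distrib power_divide)
  then show ?thesis using assms(3) by (simp add: power2_eq_iff_nonneg)
qed

text \<open>The locale applies with a \<rho> that is 1 at \<open>pi / 3\<close> and at \<beta>, and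
  hence at all three angles of the tile. The area identity is then rewritten with the area formulas
  of the tile and of the equilateral triangle.\<close>

lemma tiling_identities_ccw:
  fixes A B C U V W :: complex and \<T> :: "complex set set"
  assumes D: "side A B C > 0" and eq: "dist A B = dist B C" "dist B C = dist C A"
    and tri: "is_triangle U V W" and \<gamma>: "angle U W V = pi / 3" and irr: "angle U V W / pi \<notin> \<rat>"
    and tiling: "is_tiling N (solid_triangle U V W) (solid_triangle A B C) \<T>"
  shows "of_int (coloring_number \<T> A) * (dist V W + dist U W + dist U V) = 3 * dist A B"
    "(dist A B)\<^sup>2 = real N * (dist V W * dist U W)"
proof -
  have sum: "angle V U W + angle U V W = 2 * pi / 3" using tile_data(8)[OF tri \<gamma> refl refl refl] .
  have irr3: "angle U V W / (pi / 3) \<notin> \<rat>"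
  proof
    assume "angle U V W / (pi / 3) \<in> \<rat>"
    then have "angle U V W / (pi / 3) / 3 \<in> \<rat>" by (rule Rats_divide) simp
    then show False using irr by simp
  qed
  have "pi / 3 \<noteq> 0" by simp
  obtain \<rho> :: "real \<Rightarrow> real" where \<rho>: "\<And>u v. \<rho> (u + v) = \<rho> u + \<rho> v" "\<And>k u. \<rho> (of_int k * u) = of_int k * \<rho> u"
    "\<rho> (pi / 3) = 1" "\<rho> (angle U V W) = 1"
    by (rule additive_extension[OF \<open>pi / 3 \<noteq> 0\<close> irr3]) (rule that)
  \<comment> \<open>The two angles add up to \<open>2 * (pi / 3)\<close>.\<close>
  have "\<rho> (angle V U W) + \<rho> (angle U V W) = 2"
    using \<rho>(1)[of "angle V U W" "angle U V W"] \<rho>(2)[of 2 "pi / 3"] \<rho>(3) sum by simp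
  then have "\<rho> (angle V U W) = 1" using \<rho>(4) by simp
  then have \<rho>': "\<rho> x = 1" if "x \<in> {angle V U W, angle W V U, angle U W V}" for x
    using that \<rho>(3,4) unfolding \<gamma> angle_commute[of W V U] by blast
  define good where "good t p q r \<longleftrightarrow> t = solid_triangle p q r \<and> side p q r > 0 \<and>
    side p q r = \<bar>side U V W\<bar> \<and> dist p q + dist q r + dist r p = dist V W + dist U W + dist U V \<and>
    \<rho> (angle q p r) = 1 \<and> \<rho> (angle r q p) = 1 \<and> \<rho> (angle p r q) = 1" for t p q r
  have "\<exists>p q r. good t p q r" if "t \<in> \<T>" for t
  proof -
    have "congruent_sets (solid_triangle U V W) t" using tiling that by (simp add: is_tiling_def)
    then obtain p q r where pqr: "t = solid_triangle p q r" "side p q r > 0" "side p q r = \<bar>side U V W\<bar>"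
      "dist p q + dist q r + dist r p = dist U V + dist V W + dist W U"
      "{angle q p r, angle r q p, angle p r q} = {angle V U W, angle W V U, angle U W V}"
      using congruent_solid_triangle[OF tri] by metis
    have "\<rho> (angle q p r) = 1" "\<rho> (angle r q p) = 1" "\<rho> (angle p r q) = 1"
      using pqr(5) by (intro \<rho>'; blast)+
    then have "good t p q r" using pqr(1-4) by (simp add: good_def dist_commute)
    then show ?thesis by blast
  qed
  then obtain P Q R where PQR: "\<And>t. t \<in> \<T> \<Longrightarrow> good t (P t) (Q t) (R t)" by metis
  define E where "E t = {(P t, Q t), (Q t, R t), (R t, P t)}" for t
  \<comment> \<open>The directed edges fix the cyclic order, so any other labelling of
    \<open>E t\<close> is a rotation of the chosen one, under which area, perimeter and angle values
    are unchanged.\<close>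
  have shape: "\<rho> (angle q p r) = 1 \<and> side p q r = \<bar>side U V W\<bar> \<and>
      dist p q + dist q r + dist r p = dist V W + dist U W + dist U V"
    if "t \<in> \<T>" "E t = {(p, q), (q, r), (r, p)}" "side p q r > 0" for t p q r
  proof -
    have g: "good t (P t) (Q t) (R t)" by (rule PQR[OF that(1)])
    have "P t \<noteq> Q t" "Q t \<noteq> R t" "R t \<noteq> P t" using g boundary_edges_distinct by (auto simp: good_def)
    moreover have "(p, q) \<in> E t" "(q, r) \<in> E t" using that(2) by auto
    ultimately have "p = P t \<and> q = Q t \<and> r = R t \<or> p = Q t \<and> q = R t \<and> r = P t \<or> p = R t \<and> q = P t \<and> r = Q t"
      unfolding E_def by auto
    then consider "p = P t" "q = Q t" "r = R t" | "p = Q t" "q = R t" "r = P t"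
      | "p = R t" "q = P t" "r = Q t" by blast
    then show ?thesis
    proof cases
      case 1
      then show ?thesis using g by (simp add: good_def)
    next
      case 2
      moreover have "side (Q t) (R t) (P t) = side (P t) (Q t) (R t)" by (rule side_cycle)
      ultimately show ?thesis using g by (simp add: good_def)
    next
      case 3
      moreover have "side (R t) (P t) (Q t) = side (P t) (Q t) (R t)" by (rule side_cycle)
      ultimately show ?thesis using g by (simp add: good_def)
    qed
  qed
  interpret additive_tiling \<T> "solid_triangle A B C" E "{(A, B), (B, C), (C, A)}" A B C \<rho>
    "dist V W + dist U W + dist U V" "\<bar>side U V W\<bar>"
  proof
    show "finite \<T>" "\<Union>\<T> = solid_triangle A B C" using tiling by (auto simp: is_tiling_def)
    show "interior s \<inter> interior t = {}" if "s \<in> \<T>" "t \<in> \<T>" "s \<noteq> t" for s t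
      using tiling that by (auto simp: is_tiling_def)
    show "boundary_edges t (E t)" if "t \<in> \<T>" for t
      using PQR[OF that] unfolding boundary_edges_def E_def good_def by blast
    show "boundary_edges (solid_triangle A B C) {(A, B), (B, C), (C, A)}"
      using D unfolding boundary_edges_def by blast
  qed (fact D eq \<rho>(1-3) shape refl)+
  show "of_int (coloring_number \<T> A) * (dist V W + dist U W + dist U V) = 3 * dist A B"
    using perimeter_identity by (simp only: coloring_number_eq)
  have "card \<T> = N" using tiling by (simp add: is_tiling_def)
  then have "real N * (sqrt 3 / 2 * (dist V W * dist U W)) = sqrt 3 / 2 * (dist A B)\<^sup>2"
    using area_identity equilateral_side[OF eq D] tile_data(5)[OF tri \<gamma> refl refl refl] by simp
  then show "(dist A B)\<^sup>2 = real N * (dist V W * dist U W)" by (simp add: field_simps)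
qed

text \<open>A clockwise triangle becomes counterclockwise on exchanging \<open>B\<close> and
  \<open>C\<close>; the colouring number refers to the tiles and \<open>A\<close> only, so it is not
  affected.\<close>

lemma tiling_identities:
  fixes A B C U V W :: complex and \<T> :: "complex set set"
  assumes eq: "equilateral A B C"
    and tri: "is_triangle U V W" and \<gamma>: "angle U W V = pi / 3" and irr: "angle U V W / pi \<notin> \<rat>"
    and tiling: "is_tiling N (solid_triangle U V W) (solid_triangle A B C) \<T>"
  shows "of_int (coloring_number \<T> A) * (dist V W + dist U W + dist U V) = 3 * dist A B"
    "(dist A B)\<^sup>2 = real N * (dist V W * dist U W)"
proof -
  have s0: "side A B C \<noteq> 0" using eq is_triangle_side by (simp add: equilateral_def)
  have d: "dist A B = dist B C" "dist B C = dist C A" using eq by (simp_all add: equilateral_def)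
  have "of_int (coloring_number \<T> A) * (dist V W + dist U W + dist U V) = 3 * dist A B \<and>
    (dist A B)\<^sup>2 = real N * (dist V W * dist U W)"
  proof (cases "side A B C > 0")
    case True
    then show ?thesis using tiling_identities_ccw[OF True d tri \<gamma> irr tiling] by simp
  next
    case False
    then have "side A C B > 0" using s0 side_commute[of A C B] by simp
    moreover have "dist A C = dist C B" "dist C B = dist B A" "dist A C = dist A B"
      using d by (simp_all add: dist_commute)
    ultimately show ?thesis
      using tiling_identities_ccw[of A C B, OF _ _ _ tri \<gamma> irr] tiling
      by (simp add: solid_triangle_commute[of A C B])
  qed
  then show "of_int (coloring_number \<T> A) * (dist V W + dist U W + dist U V) = 3 * dist A B"
    "(dist A B)\<^sup>2 = real N * (dist V W * dist U W)" by simp_all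
qed

theorem theorem2:
  shows "\<exists>p q r :: complex poly poly.
    poly2_over Q_isqrt3 p \<and> poly2_over Q_isqrt3 q \<and> poly2_over Q_isqrt3 r \<and>
    (\<forall>(A :: complex) (B :: complex) (C :: complex) (U :: complex) (V :: complex) (W :: complex)
      (\<alpha> :: real) (\<beta> :: real) (a :: real) (b :: real) (c :: real)
      (\<T> :: complex set set) (N :: nat) (M :: int).
      equilateral A B C \<and>
      is_triangle U V W \<and>
      \<alpha> = angle V U W \<and> \<beta> = angle U V W \<and> angle U W V = pi / 3 \<and>
      a = dist V W \<and> b = dist U W \<and> c = dist U V \<and>
      \<beta> / pi \<notin> \<rat> \<and>
      is_tiling N (solid_triangle U V W) (solid_triangle A B C) \<T> \<and>
      M = coloring_number \<T> A
      \<longrightarrow>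
      (let \<zeta> = exp (\<i> * complex_of_real \<alpha>);
           P = eval2 p (of_nat N) (of_int M);
           Q = eval2 q (of_nat N) (of_int M);
           R = eval2 r (of_nat N) (of_int M)
       in P \<noteq> 0 \<and> P * \<zeta>\<^sup>2 + Q * \<zeta> + R = 0) \<and>
      (let n = real N;
           m = real_of_int M;
           u = (3 * n + m\<^sup>2) / (3 * n - m\<^sup>2);
           v = sqrt ((9 * n - m\<^sup>2) * (n - m\<^sup>2)) / (3 * n - m\<^sup>2)
       in {a / c, b / c} = {1 / 2 * (u + v), 1 / 2 * (u - v)}) \<and>
      M\<^sup>2 < int N)"
proof (intro exI conjI allI impI; (elim conjE)?)
  \<comment> \<open>The witnesses encode \<open>k * cnj \<omega>\<close>, \<open>- l\<close> and
    \<open>k * \<omega>\<close> from \<open>cis_quadratic\<close> with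
    \<open>k = 3 * N - M\<^sup>2\<close> and \<open>l = 3 * N + M\<^sup>2\<close>.\<close>
  show "poly2_over Q_isqrt3 (linear_quadratic (of_nat 3 * cnj \<omega>) (- cnj \<omega>))"
    "poly2_over Q_isqrt3 (linear_quadratic (- of_nat 3) (- 1))"
    "poly2_over Q_isqrt3 (linear_quadratic (of_nat 3 * \<omega>) (- \<omega>))"
    by (intro poly2_over_linear_quadratic Q_isqrt3_minus Q_isqrt3_closed Q_isqrt3_of_nat Q_isqrt3_omega)+
next
  fix A B C U V W :: complex and \<alpha> \<beta> a b c :: real and \<T> :: "complex set set" and N :: nat and M :: int
  assume eq: "equilateral A B C" and tri: "is_triangle U V W"
    and \<alpha>: "\<alpha> = angle V U W" and \<beta>: "\<beta> = angle U V W" "\<beta> / pi \<notin> \<rat>" and \<gamma>: "angle U W V = pi / 3"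
    and abc: "a = dist V W" "b = dist U W" "c = dist U V"
    and tiling: "is_tiling N (solid_triangle U V W) (solid_triangle A B C) \<T>"
    and M: "M = coloring_number \<T> A"
  note tile = tile_data[OF tri \<gamma> abc]
  define n m where "n = real N" and "m = real_of_int M"
  have "m * (a + b + c) = 3 * dist A B" "(dist A B)\<^sup>2 = n * (a * b)"
    using tiling_identities[OF eq tri \<gamma> \<beta>(2)[unfolded \<beta>(1)] tiling]
    by (simp_all add: m_def n_def M abc add.assoc)
  moreover have "dist A B > 0"
    using eq is_triangle_side[of A B C] by (auto simp: equilateral_def side_def cross_def)
  \<comment> \<open>An equilateral tile would give \<open>\<beta> = pi / 3\<close>, a rational
    multiple of \<open>pi\<close>.\<close>
  moreover have "a \<noteq> b"
  proof
    assume "a = b"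
    then have "\<beta> = pi / 3" using tile(9) \<beta>(1) by simp
    then have "\<beta> / pi = 1 / 3" by simp
    moreover have "1 / 3 \<in> (\<rat> :: real set)" by (rule Rats_divide) simp_all
    ultimately show False using \<beta>(2) by metis
  qed
  ultimately have res: "m\<^sup>2 < n" "(3 * n - m\<^sup>2) * (a + b) = (3 * n + m\<^sup>2) * c"
    "{a / c, b / c} =
      {1 / 2 * ((3 * n + m\<^sup>2) / (3 * n - m\<^sup>2) + sqrt ((9 * n - m\<^sup>2) * (n - m\<^sup>2)) / (3 * n - m\<^sup>2)),
       1 / 2 * ((3 * n + m\<^sup>2) / (3 * n - m\<^sup>2) - sqrt ((9 * n - m\<^sup>2) * (n - m\<^sup>2)) / (3 * n - m\<^sup>2))}"
    using ratios_from_invariants[OF tile(1-3) _ _ tile(4)] by blast+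
  have "real_of_int (M\<^sup>2) < real_of_int (int N)" using res(1) by (simp add: n_def m_def)
  then show "M\<^sup>2 < int N" by (simp only: of_int_less_iff)
  show "let n = real N; m = real_of_int M; u = (3 * n + m\<^sup>2) / (3 * n - m\<^sup>2);
           v = sqrt ((9 * n - m\<^sup>2) * (n - m\<^sup>2)) / (3 * n - m\<^sup>2)
       in {a / c, b / c} = {1 / 2 * (u + v), 1 / 2 * (u - v)}"
    unfolding Let_def using res(3) unfolding n_def m_def .
  have "eval2 (linear_quadratic (of_nat 3 * cnj \<omega>) (- cnj \<omega>)) (of_nat N) (of_int M)
      = of_real (3 * n - m\<^sup>2) * cnj \<omega>"
    "eval2 (linear_quadratic (- of_nat 3) (- 1)) (of_nat N) (of_int M) = - of_real (3 * n + m\<^sup>2)"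
    "eval2 (linear_quadratic (of_nat 3 * \<omega>) (- \<omega>)) (of_nat N) (of_int M) = of_real (3 * n - m\<^sup>2) * \<omega>"
    by (simp_all add: eval2_linear_quadratic n_def m_def algebra_simps)
  moreover have "exp (\<i> * complex_of_real \<alpha>) = cis \<alpha>" by (simp add: cis_conv_exp)
  \<comment> \<open>The bound \<open>m\<^sup>2 < n\<close> keeps the leading coefficient nonzero, so
    the equation is genuinely quadratic.\<close>
  moreover have "3 * n - m\<^sup>2 \<noteq> 0" using res(1) by (smt (verit) zero_le_power2)
  then have "of_real (3 * n - m\<^sup>2) * cnj \<omega> \<noteq> 0" by (simp add: \<omega>_def del: of_real_diff)
  moreover have "of_real (3 * n - m\<^sup>2) * cnj \<omega> * (cis \<alpha>)\<^sup>2 + - of_real (3 * n + m\<^sup>2) * cis \<alpha>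
      + of_real (3 * n - m\<^sup>2) * \<omega> = 0"
    by (rule cis_quadratic[OF tile(1-4) tile(6,7)[folded \<alpha>] res(2)])
  ultimately show "let \<zeta> = exp (\<i> * complex_of_real \<alpha>);
           P = eval2 (linear_quadratic (of_nat 3 * cnj \<omega>) (- cnj \<omega>)) (of_nat N) (of_int M);
           Q = eval2 (linear_quadratic (- of_nat 3) (- 1)) (of_nat N) (of_int M);
           R = eval2 (linear_quadratic (of_nat 3 * \<omega>) (- \<omega>)) (of_nat N) (of_int M)
       in P \<noteq> 0 \<and> P * \<zeta>\<^sup>2 + Q * \<zeta> + R = 0"
    unfolding Let_def by simp
qed

end
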